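(* Let \[ F(z)=\sum_{n\ge 0} a_n z^n\in \mathbb{C}(z), \] and suppose that $a_n=0$ for infinitely many $n$. Then among the poles of $F$ having minimum modulus, at least two have quotient a root of unity.
   Context: Here $F\in\mathbb{C}(z)$ is a rational function with complex coefficients, identified with its power series expansion $\sum_{n\ge 0} a_n z^n\in\mathbb{C}[[z]]$ at $z=0$. The poles of minimum modulus are those poles $\alpha\in\mathbb{C}$ of $F$ for which $|\alpha|$ is smallest among the absolute values of all poles of $F$ in $\mathbb{C}$.
   Formalization: The formal theorem additionally assumes that F has at least one pole in the complex plane, i.e. that F is not a polynomial; for polynomials (e.g. F = 1) the claim as stated is false, since there are no poles. *)

theory Defs
  imports "HOL-Complex_Analysis.Complex_Analysis" "HOL-Computational_Algebra.Computational_Algebra"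
    "HOL-Computational_Algebra.Field_as_Ring"
begin

text \<open>
  The field of rational functions over the complex numbers is the type
  \<^typ>\<open>complex poly fract\<close>. A rational function is evaluated through its fraction in lowest
  terms, so removable singularities are filled in; at a pole the value is 0, because division
  by 0 yields 0.
\<close>

definition rat_fun :: "complex poly fract \<Rightarrow> complex \<Rightarrow> complex" where
  "rat_fun F z = poly (fst (quot_of_fract F)) z / poly (snd (quot_of_fract F)) z"

definition rat_poles :: "complex poly fract \<Rightarrow> complex set" where
  "rat_poles F = {\<alpha>. is_pole (rat_fun F) \<alpha>}"

definition min_modulus_poles :: "complex poly fract \<Rightarrow> complex set" where
  "min_modulus_poles F = {\<alpha> \<in> rat_poles F. \<forall>\<beta> \<in> rat_poles F. cmod \<alpha> \<le> cmod \<beta>}"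

definition root_of_unity :: "complex \<Rightarrow> bool" where
  "root_of_unity w \<longleftrightarrow> (\<exists>k::nat. k \<ge> 1 \<and> w ^ k = 1)"

end

theory Submission
  imports Defs
begin

text \<open>
  Let \<alpha> be a pole of least modulus. The proof has an arithmetic half and an analytic half.

  Analytic half (\<open>root_of_unity_filter\<close>, \<open>pole_ratio_root_of_unity\<close>). Suppose that the coefficients
  vanish along a whole arithmetic progression, a(N m + r) = 0 for all m. With w = exp(2 \<pi> i / N), the
  average of the rotated functions w^(-j r) F(w^j z) over j < N picks out exactly these coefficients,
  up to finitely many of small index, so it is a polynomial near 0, and by analytic continuation
  everywhere off the poles. The term j = 0 has a pole at \<alpha>; another term has to cancel it, so
  w^j \<alpha> is a pole of F for some 0 < j < N. It lies on the same circle as \<alpha>, and the two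
  poles have a root of unity other than 1 as quotient.

  Arithmetic half (\<open>skolem_mahler_lech\<close>). The coefficients of a rational function are eventually
  sums of terms c (n choose i) l^n, and such a sequence with infinitely many zeros does vanish along
  an arithmetic progression. This is the theorem of Skolem, Mahler and Lech; the proof follows
  Hansel's elementary form of the p-adic argument. The numbers c, l, 1/l lie in a finitely generated
  field K, and one looks for a subring V of K containing them that behaves like the intersection of K
  with the p-adic integers (\<open>padic_ring\<close>): p is not invertible in V, every element of K enters V
  after multiplication by a power of p, every finite subset of V generates a finite ring modulo p,
  and the elements of 1 + p V are units. Finiteness gives an exponent N with l^N in 1 + p^2 V
  (\<open>unit_power_cong_one\<close>). Then m \<mapsto> l^(N m) and with it the whole sequence along a progression of
  difference N is interpolated by polynomials whose coefficient of x^k is divisible by p^(k - D). Each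
  integer zero can be divided out of these polynomials, and in doing so the divisibility of the high
  coefficients moves down to all coefficients; hence k + D zeros force every value to be divisible by
  p^k, and infinitely many zeros force every value to be 0 (\<open>analytic_zero\<close>).

  Existence of V (\<open>ex_has_padic_rings\<close>) goes by adjoining one number at a time to the rationals. Over
  the rationals V is the localisation of the integers at p, where p avoids the denominators. For x
  algebraic over K, choose V so as to contain the coefficients of the minimal polynomial of x and
  localise V[x]. For t transcendental over K, Lech embeds K(t) into the p-adic numbers by sending t to
  a p-adic integer that is transcendental over K. Here this p-adic integer is replaced by a Cauchy
  sequence of integers, built by diagonalisation over the countably many polynomials over K so that
  each of them takes values of bounded p-divisibility along it; an element f(t)/g(t)
  belongs to the new ring if its values along the sequence eventually lie in V.
\<close>

section \<open>Subrings of a field and polynomials over them\<close>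

locale subring_set =
  fixes V :: "'a::field_char_0 set"
  assumes one_in [simp]: "1 \<in> V"
    and diff_in [simp]: "x \<in> V \<Longrightarrow> y \<in> V \<Longrightarrow> x - y \<in> V"
    and mult_in [simp]: "x \<in> V \<Longrightarrow> y \<in> V \<Longrightarrow> x * y \<in> V"
begin

lemma zero_in [simp]: "0 \<in> V"
  using diff_in[OF one_in one_in] by (simp del: diff_in)

lemma uminus_in [simp]: "x \<in> V \<Longrightarrow> - x \<in> V"
  using diff_in[of 0 x] by (simp del: diff_in)

lemma add_in [simp]: "x \<in> V \<Longrightarrow> y \<in> V \<Longrightarrow> x + y \<in> V"
  using diff_in[of x "- y"] by (simp del: diff_in)

lemma power_in [simp]: "x \<in> V \<Longrightarrow> x ^ n \<in> V"
  by (induction n) auto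

lemma of_nat_in [simp]: "of_nat n \<in> V"
  by (induction n) auto

lemma of_int_in [simp]: "of_int n \<in> V"
  by (cases n) (auto simp del: of_nat_Suc)

lemma sum_in [simp]: "(\<And>i. i \<in> I \<Longrightarrow> f i \<in> V) \<Longrightarrow> sum f I \<in> V"
  by (induction I rule: infinite_finite_induct) auto

end

definition polys_over :: "'a::field_char_0 set \<Rightarrow> 'a poly set" where
  "polys_over A = {f. \<forall>i. coeff f i \<in> A}"

context subring_set
begin

lemma polys_over_0 [simp]: "0 \<in> polys_over V"
  by (auto simp: polys_over_def)

lemma polys_over_pCons [simp]: "c \<in> V \<Longrightarrow> f \<in> polys_over V \<Longrightarrow> pCons c f \<in> polys_over V"
  by (auto simp: polys_over_def coeff_pCons split: nat.splits)

lemma polys_over_1 [simp]: "1 \<in> polys_over V"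
  unfolding one_pCons by auto

lemma polys_over_add [simp]: "f \<in> polys_over V \<Longrightarrow> g \<in> polys_over V \<Longrightarrow> f + g \<in> polys_over V"
  by (auto simp: polys_over_def)

lemma polys_over_diff [simp]: "f \<in> polys_over V \<Longrightarrow> g \<in> polys_over V \<Longrightarrow> f - g \<in> polys_over V"
  by (auto simp: polys_over_def)

lemma polys_over_smult [simp]: "c \<in> V \<Longrightarrow> f \<in> polys_over V \<Longrightarrow> smult c f \<in> polys_over V"
  by (auto simp: polys_over_def)

lemma polys_over_mult [simp]: "f \<in> polys_over V \<Longrightarrow> g \<in> polys_over V \<Longrightarrow> f * g \<in> polys_over V"
  by (auto simp: polys_over_def coeff_mult)

lemma polys_over_prod [simp]:
  "(\<And>i. i \<in> I \<Longrightarrow> f i \<in> polys_over V) \<Longrightarrow> prod f I \<in> polys_over V"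
  by (induction I rule: infinite_finite_induct) auto

lemma poly_in [simp]: "f \<in> polys_over V \<Longrightarrow> x \<in> V \<Longrightarrow> poly f x \<in> V"
  by (auto simp: polys_over_def poly_altdef)

end


lemma polys_over_mono: "A \<subseteq> B \<Longrightarrow> polys_over A \<subseteq> polys_over B"
  by (auto simp: polys_over_def)

lemma polys_over_pConsD:
  assumes "pCons a f \<in> polys_over A"
  shows "a \<in> A \<and> f \<in> polys_over A"
proof
  have *: "coeff (pCons a f) i \<in> A" for i using assms unfolding polys_over_def by blast
  show "a \<in> A" using *[of 0] by simp
  show "f \<in> polys_over A" unfolding polys_over_def using *[of "Suc _"] by simp
qed

lemma finite_coeffs: "finite (range (coeff f))"
proof -
  have "range (coeff f) \<subseteq> insert 0 (coeff f ` {..degree f})"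
    using le_degree by fastforce
  then show ?thesis by (rule finite_subset) simp
qed

lemma countable_polys_over:
  assumes "countable A"
  shows "countable (polys_over A)"
proof -
  have "polys_over A \<subseteq> Poly ` lists A"
  proof
    fix f assume f: "f \<in> polys_over A"
    have "set (coeffs f) \<subseteq> A" using f by (auto simp: polys_over_def coeffs_def)
    then show "f \<in> Poly ` lists A" by (intro image_eqI[of _ _ "coeffs f"]) auto
  qed
  then show ?thesis using assms by (auto intro: countable_subset)
qed

lemma finite_polys_over_bounded:
  assumes "finite A"
  shows "finite {f \<in> polys_over A. degree f < d}"
proof -
  have "{f \<in> polys_over A. degree f < d} \<subseteq> Poly ` {xs. set xs \<subseteq> A \<and> length xs \<le> d}"
  proof
    fix f assume f: "f \<in> {f \<in> polys_over A. degree f < d}"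
    have "set (coeffs f) \<subseteq> A" using f by (auto simp: polys_over_def coeffs_def)
    moreover have "length (coeffs f) \<le> d" using f by (auto simp: coeffs_def)
    ultimately show "f \<in> Poly ` {xs. set xs \<subseteq> A \<and> length xs \<le> d}"
      by (intro image_eqI[of _ _ "coeffs f"]) auto
  qed
  then show ?thesis by (rule finite_subset) (use assms in \<open>simp add: finite_lists_length_le\<close>)
qed

lemma (in subring_set) monic_division:
  assumes "h \<in> polys_over V" "lead_coeff h = 1" "degree h > 0" "f \<in> polys_over V"
  shows "\<exists>q\<in>polys_over V. \<exists>r\<in>polys_over V. f = q * h + r \<and> degree r < degree h"
  using assms(4)
proof (induction f)
  case 0
  then show ?case using assms(3) by (intro bexI[of _ 0]) auto
next
  case (pCons a f)
  have af: "a \<in> V" "f \<in> polys_over V"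
    using polys_over_pConsD[OF pCons.prems] by blast+
  obtain q r where q: "q \<in> polys_over V" "r \<in> polys_over V" "f = q * h + r" "degree r < degree h"
    using pCons.IH[OF af(2)] by blast
  define c where "c = coeff (pCons a r) (degree h)"
  define r' where "r' = pCons a r - smult c h"
  have c: "c \<in> V" using af q polys_over_pCons[of a r] by (simp add: c_def polys_over_def)
  have "pCons a f = (pCons 0 q + [:c:]) * h + r'"
    unfolding q(3) r'_def by (simp add: algebra_simps)
  moreover have "r' \<in> polys_over V" using af q c assms(1) by (simp add: r'_def)
  moreover have "pCons 0 q + [:c:] \<in> polys_over V" using q c by simp
  moreover have "degree r' < degree h"
  proof (rule degree_lessI)
    show "\<forall>k\<ge>degree h. coeff r' k = 0"
    proof (intro allI impI)
      fix k assume "k \<ge> degree h"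
      then consider "k = degree h" | "k > degree h" by linarith
      then show "coeff r' k = 0"
      proof cases
        case 1
        then show ?thesis using assms(2) by (simp add: r'_def c_def)
      next
        case 2
        then have "degree (pCons a r) < k" using degree_pCons_le[of a r] q(4) by linarith
        then show ?thesis using 2 by (simp add: r'_def coeff_eq_0)
      qed
    qed
  qed (use assms(3) in simp)
  ultimately show ?case by blast
qed

section \<open>Rings that imitate the p-adic integers\<close>

text \<open>
  A nonempty finite T with this property represents a finite ring inside V/cV, because a nonempty
  finite subset of a group that is closed under addition is a subgroup.
\<close>

definition closed_mod :: "'a::field_char_0 \<Rightarrow> 'a set \<Rightarrow> 'a set \<Rightarrow> bool" where
  "closed_mod c V T \<longleftrightarrow> T \<subseteq> V \<and>
     (\<forall>x\<in>T. \<forall>y\<in>T. \<exists>z\<in>T. \<exists>v\<in>V. x + y = z + c * v) \<and>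
     (\<forall>x\<in>T. \<forall>y\<in>T. \<exists>z\<in>T. \<exists>v\<in>V. x * y = z + c * v)"

text \<open>
  The model is a number field K with the ring V of elements that are integral at the primes above p.
  The quotient V/pV may be infinite and may have zero divisors; what matters is that finitely many
  elements of it always lie in a finite ring. The last assumption says this in terms of
  representatives.
\<close>

locale residual_ring = subring_set V + K: subring_set K
  for p :: nat and K V :: "'a::field_char_0 set" +
  assumes prime_p: "prime p"
    and inverse_K: "x \<in> K \<Longrightarrow> inverse x \<in> K"
    and V_subset: "V \<subseteq> K"
    and p_denominator: "x \<in> K \<Longrightarrow> \<exists>s. of_nat p ^ s * x \<in> V"
    and p_not_unit: "inverse (of_nat p) \<notin> V"
    and residues_finite: "finite Y \<Longrightarrow> Y \<subseteq> V \<Longrightarrow> \<exists>T. finite T \<and> Y \<subseteq> T \<and> closed_mod (of_nat p) V T"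
begin

lemma p_pos [simp]: "p > 0" "p \<noteq> 0"
  using prime_gt_0_nat[OF prime_p] by simp_all

text \<open>
  The inverse of a nonzero x has only a bounded power of p in its denominator, which bounds the power
  of p that can divide x.
\<close>

lemma not_divisible_by_all_p_powers:
  assumes "x \<in> K" "\<And>k. \<exists>v\<in>V. x = of_nat p ^ k * v"
  shows "x = 0"
proof (rule ccontr)
  assume "x \<noteq> 0"
  obtain s where s: "of_nat p ^ s * inverse x \<in> V"
    using p_denominator[OF inverse_K[OF assms(1)]] by blast
  obtain v where v: "v \<in> V" "x = of_nat p ^ Suc s * v"
    using assms(2) by blast
  have "inverse (of_nat p) = (of_nat p ^ s * inverse x) * v"
    using \<open>x \<noteq> 0\<close> v(2) by (simp add: field_simps)
  also have "\<dots> \<in> V" using s v by simp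
  finally show False using p_not_unit by contradiction
qed

text \<open>
  The powers of b stay in a finite ring modulo p, so two of them agree there.
\<close>

lemma ex_power_cong:
  assumes "b \<in> V"
  shows "\<exists>i j. i < j \<and> (\<exists>v\<in>V. b ^ j = b ^ i + of_nat p * v)"
proof -
  have "finite {b}" "{b} \<subseteq> V" using assms by auto
  from residues_finite[OF this] obtain T where T: "finite T" "{b} \<subseteq> T" "closed_mod (of_nat p) V T"
    by blast
  have "\<exists>z\<in>T. \<exists>v\<in>V. b ^ Suc n = z + of_nat p * v" for n
  proof (induction n)
    case 0
    have "b ^ Suc 0 = b + of_nat p * 0" by simp
    then show ?case using T(2) zero_in by blast
  next
    case (Suc n)
    then obtain z v where z: "z \<in> T" "v \<in> V" "b ^ Suc n = z + of_nat p * v" by blast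
    obtain z' v' where z': "z' \<in> T" "v' \<in> V" "b * z = z' + of_nat p * v'"
      using T z unfolding closed_mod_def by blast
    have "b ^ Suc (Suc n) = b * z + of_nat p * (b * v)"
      using z(3) by (simp add: algebra_simps)
    also have "\<dots> = z' + of_nat p * (v' + b * v)"
      using z'(3) by (simp add: algebra_simps)
    finally show ?case using z'(1) z' z assms by (intro bexI[OF _ z'(1)] bexI[of _ "v' + b * v"]) simp_all
  qed
  then obtain z v where zv: "\<And>n. z n \<in> T" "\<And>n. v n \<in> V" "\<And>n. b ^ Suc n = z n + of_nat p * v n"
    by metis
  have "finite (range z)"
    using T(1) zv(1) by (auto intro: finite_subset[OF _ T(1)])
  then have "\<not> inj z"
    using finite_imageD by blast
  then obtain i j where ij: "i < j" "z i = z j"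
    unfolding inj_def by (metis linorder_neqE_nat)
  have "b ^ Suc j = b ^ Suc i + of_nat p * (v j - v i)"
    using zv(3)[of i] zv(3)[of j] ij by (simp add: algebra_simps del: power_Suc)
  then show ?thesis using ij zv(2)
    by (intro exI[of _ "Suc i"] exI[of _ "Suc j"] conjI bexI[of _ "v j - v i"]) simp_all
qed

lemma one_plus_power:
  assumes "x \<in> V"
  shows "\<exists>w\<in>V. (1 + x) ^ n = 1 + of_nat n * x + x ^ 2 * w"
proof (induction n)
  case 0
  then show ?case by (intro bexI[of _ 0]) simp_all
next
  case (Suc n)
  then obtain w where w: "w \<in> V" "(1 + x) ^ n = 1 + of_nat n * x + x ^ 2 * w" by blast
  have "(1 + x) ^ Suc n = 1 + of_nat (Suc n) * x + x ^ 2 * (of_nat n + w + x * w)"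
    by (simp add: w(2) algebra_simps power2_eq_square)
  then show ?case using w assms by (intro bexI[of _ "of_nat n + w + x * w"]) simp_all
qed

text \<open>
  Two powers of b agree modulo p and b is a unit, so some power is 1 modulo p. A further p-th power
  improves this to a congruence modulo p^2. The square is what makes the binomial series of
  (1 + p^2 v)^m have coefficients of growing divisibility for every prime, p = 2 included: the
  denominator i! absorbs at most i of the 2 i factors p.
\<close>

lemma unit_power_cong_one:
  assumes "b \<in> V" "inverse b \<in> V" "b \<noteq> 0"
  shows "\<exists>N\<ge>1. \<exists>v\<in>V. b ^ N = 1 + of_nat p ^ 2 * v"
proof -
  obtain i j v where ij: "i < j" "v \<in> V" "b ^ j = b ^ i + of_nat p * v"
    using ex_power_cong[OF assms(1)] by blast
  define w where "w = inverse b ^ i * v"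
  have w: "w \<in> V" unfolding w_def using assms ij by simp
  have "b ^ j = b ^ i * b ^ (j - i)" using ij by (simp flip: power_add)
  then have 1: "b ^ (j - i) = 1 + of_nat p * w"
    using ij(3) assms(3) by (simp add: w_def field_simps)
  have "of_nat p * w \<in> V" using w by simp
  from one_plus_power[OF this, of p] obtain u where u: "u \<in> V"
    "(1 + of_nat p * w) ^ p = 1 + of_nat p * (of_nat p * w) + (of_nat p * w) ^ 2 * u" by blast
  have "b ^ ((j - i) * p) = (1 + of_nat p * w) ^ p"
    by (simp add: power_mult 1)
  also have "\<dots> = 1 + of_nat p ^ 2 * (w + w ^ 2 * u)"
    unfolding u(2) by (simp add: power_mult_distrib algebra_simps power2_eq_square)
  finally have "b ^ ((j - i) * p) = 1 + of_nat p ^ 2 * (w + w ^ 2 * u)" .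
  moreover have "(j - i) * p \<ge> 1" using ij prime_p prime_gt_0_nat by (simp add: Suc_le_eq)
  moreover have "w + w ^ 2 * u \<in> V" using w u by simp
  ultimately show ?thesis by blast
qed

end

text \<open>
  Units in 1 + pV replace completeness: a number that is close enough to a unit of V is again a unit.
\<close>

locale padic_ring = residual_ring p K V
  for p :: nat and K V :: "'a::field_char_0 set" +
  assumes one_plus_p_unit: "x \<in> V \<Longrightarrow> inverse (1 + of_nat p * x) \<in> V"
begin

text \<open>
  By Bezout an integer prime to p divides some integer of the form 1 + p l.
\<close>

lemma inverse_of_int_in:
  assumes "\<not> int p dvd n"
  shows "inverse (of_int n) \<in> V"
proof -
  have "prime (int p)" using prime_p by simp
  then have "coprime (int p) n" using assms by (rule prime_imp_coprime)
  then have "gcd n (int p) = 1" by (metis coprime_imp_gcd_eq_1 gcd.commute)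
  then obtain m l where ml: "m * n + l * int p = 1"
    using bezout_int[of n "int p"] by metis
  have "(of_int (m * n) :: 'a) = of_int (1 + int p * (- l))"
    using ml by (intro arg_cong[of _ _ of_int]) (simp add: algebra_simps)
  then have *: "of_int m * of_int n = (1 + of_nat p * of_int (- l) :: 'a)" by simp
  have "n \<noteq> 0" using assms by auto
  have "m \<noteq> 0"
  proof
    assume "m = 0"
    then have "int p dvd 1" using ml by (metis add_0 dvd_triv_right mult_zero_left)
    then show False using prime_p by (simp add: not_prime_1 prime_nat_iff)
  qed
  have "inverse (of_int n) = of_int m * inverse (1 + of_nat p * of_int (- l) :: 'a)"
    unfolding *[symmetric] using \<open>n \<noteq> 0\<close> \<open>m \<noteq> 0\<close> by simp
  also have "\<dots> \<in> V" by (intro mult_in one_plus_p_unit) simp_all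
  finally show ?thesis .
qed

end

lemma (in residual_ring) common_denominator:
  assumes "finite A" "A \<subseteq> K"
  shows "\<exists>s. \<forall>x\<in>A. of_nat p ^ s * x \<in> V"
  using assms
proof (induction A rule: finite_induct)
  case (insert y A)
  obtain s where s: "\<forall>x\<in>A. of_nat p ^ s * x \<in> V" using insert by auto
  obtain t where t: "of_nat p ^ t * y \<in> V" using p_denominator insert.prems by blast
  have "of_nat p ^ (s + t) * x \<in> V" if "x \<in> insert y A" for x
  proof (cases "x = y")
    case True
    then have "of_nat p ^ (s + t) * x = of_nat p ^ s * (of_nat p ^ t * y)"
      by (simp add: power_add mult.assoc)
    then show ?thesis using t by simp
  next
    case False
    have "of_nat p ^ t * (of_nat p ^ s * x) \<in> V" using s that False by simp
    then show ?thesis by (simp add: power_add mult_ac)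
  qed
  then show ?case by blast
qed simp

lemma (in residual_ring) poly_common_denominator:
  assumes "f \<in> polys_over K"
  shows "\<exists>s. smult (of_nat p ^ s) f \<in> polys_over V"
  using common_denominator[OF finite_coeffs[of f]] assms by (fastforce simp: polys_over_def)

section \<open>Sequences that are p-adically analytic\<close>

text \<open>
  With n = p q + r, the multiples of p among 1, ..., n
  contribute p^q q!, the other factors are prime to p, and one recurses on q; the exponent stays at
  most n because 2 q \<le> n.
\<close>

lemma fact_dvd_prime_power:
  fixes p :: nat
  assumes "prime p"
  shows "\<exists>u. \<not> p dvd u \<and> fact n dvd p ^ n * u"
proof (induction n rule: less_induct)
  case (less n)
  show ?case
  proof (cases "n = 0")
    case True
    then show ?thesis using assms by (intro exI[of _ 1]) (auto simp: not_prime_1)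
  next
    case False
    define q r where "q = n div p" and "r = n mod p"
    have p: "p > 1" using assms prime_gt_1_nat by blast
    have n: "n = p * q + r" "r < p" unfolding q_def r_def using p by auto
    have qn: "q < n" unfolding q_def using False p by simp
    then obtain u where u: "\<not> p dvd u" "fact q dvd p ^ q * u" using less by blast
    \<comment> \<open>the factor w collects the numbers up to p k + r that are prime to p\<close>
    have "\<exists>w. \<not> p dvd w \<and> fact (p * k + r) = p ^ k * fact k * w" if "r < p" for k r :: nat
      using that
    proof (induction k arbitrary: r)
      case 0
      then show ?case using assms by (auto simp: prime_dvd_fact_iff)
    next
      case (Suc k)
      show ?case using Suc.prems
      proof (induction r)
        case 0
        obtain w where w: "\<not> p dvd w" "fact (p * k + (p - 1)) = p ^ k * fact k * w"
          using Suc.IH[of "p - 1"] p by auto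
        have "p * Suc k = Suc (p * k + (p - 1))" using p by simp
        then have "fact (p * Suc k) = p * Suc k * fact (p * k + (p - 1))"
          by (simp only: fact_Suc of_nat_id)
        then show ?case using w by (intro exI[of _ w]) (simp add: algebra_simps)
      next
        case (Suc r)
        then obtain w where w: "\<not> p dvd w" "fact (p * Suc k + r) = p ^ Suc k * fact (Suc k) * w"
          by auto
        have "\<not> p dvd Suc (p * Suc k + r)"
        proof
          assume "p dvd Suc (p * Suc k + r)"
          then have "p dvd p * Suc k + Suc r" by simp
          then have "p dvd Suc r" using dvd_add_right_iff[of p "p * Suc k" "Suc r"] by simp
          then show False using Suc.prems by (auto dest: dvd_imp_le)
        qed
        then have "\<not> p dvd Suc (p * Suc k + r) * w"
          using w(1) assms by (simp only: prime_dvd_mult_iff) simp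
        moreover have "fact (p * Suc k + Suc r) = p ^ Suc k * fact (Suc k) * (Suc (p * Suc k + r) * w)"
          using w(2) fact_Suc[of "p * Suc k + r", where 'a=nat] by (simp only: add_Suc_right of_nat_id mult_ac)
        ultimately show ?case by blast
      qed
    qed
    from this[OF n(2), of q] obtain w where w: "\<not> p dvd w" "fact n = p ^ q * fact q * w"
      using n(1) by auto
    have "2 * q \<le> n" using n p by (metis add_leD1 le_add1 mult_le_mono1 Suc_leI one_add_one plus_1_eq_Suc le_trans)
    then have e: "p ^ n = p ^ (n - 2 * q) * p ^ q * p ^ q"
      by (simp flip: power_add)
    have "fact n dvd p ^ q * (p ^ q * u) * w"
      unfolding w(2) using u(2) by (intro mult_dvd_mono) auto
    also have "\<dots> dvd p ^ n * (u * w)"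
      unfolding e by (simp add: mult_ac)
    finally show ?thesis using u(1) w(1) assms prime_dvd_mult_iff by blast
  qed
qed

context subring_set
begin

text \<open>
  Horner's scheme for division by x - z computes each coefficient of the quotient from the
  coefficients of higher index in the dividend. So if c divides the coefficients of index at least
  card Z, then after division by all card Z linear factors it divides every coefficient.
\<close>

lemma quotient_by_roots:
  assumes "finite Z" "\<forall>z\<in>Z. z \<in> V" "\<forall>z\<in>Z. poly R z = 0"
    and "\<forall>j\<ge>card Z. \<exists>v\<in>V. coeff R j = c * v"
  shows "\<exists>Q. R = (\<Prod>z\<in>Z. [:- z, 1:]) * Q \<and> (\<forall>j. \<exists>v\<in>V. coeff Q j = c * v)"
  using assms
proof (induction Z arbitrary: R rule: finite_induct)
  case empty
  then show ?case by auto
next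
  case (insert z Z)
  obtain R1 where R1: "R = [:- z, 1:] * R1"
    using insert.prems(2) by (auto simp: poly_eq_0_iff_dvd elim: dvdE)
  have rec: "coeff R1 j = coeff R (Suc j) + z * coeff R1 (Suc j)" for j
    unfolding R1 by simp
  have "\<exists>v\<in>V. coeff R1 j = c * v" if "j \<ge> card Z" for j
    using that
  proof (induction "degree R1 - j" arbitrary: j)
    case 0
    then have "coeff R1 (Suc j) = 0" by (intro coeff_eq_0) simp
    moreover have "Suc j \<ge> card (insert z Z)" using 0 insert.hyps by simp
    ultimately show ?case using rec[of j] insert.prems(3) by simp
  next
    case (Suc d)
    then obtain v where v: "v \<in> V" "coeff R1 (Suc j) = c * v" by (metis Suc_diff_Suc Suc_leD Suc_le_mono diff_Suc_Suc le_SucI zero_less_Suc zero_less_diff diff_Suc_eq_diff_pred diff_Suc_1' diff_commute)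
    obtain w where w: "w \<in> V" "coeff R (Suc j) = c * w" using insert Suc.prems by auto
    have "coeff R1 j = c * (w + z * v)" using rec[of j] v w by (simp add: algebra_simps)
    moreover have "w + z * v \<in> V" using insert.prems v w by simp
    ultimately show ?case by blast
  qed
  moreover have "\<forall>y\<in>Z. poly R1 y = 0" using insert.prems(2) insert.hyps(2) by (auto simp: R1)
  ultimately obtain Q where Q: "R1 = (\<Prod>z\<in>Z. [:- z, 1:]) * Q" "\<forall>j. \<exists>v\<in>V. coeff Q j = c * v"
    using insert.IH[of R1] insert.prems(1) by blast
  have "R = (\<Prod>z\<in>insert z Z. [:- z, 1:]) * Q"
    unfolding R1 Q(1) prod.insert[OF insert.hyps] by (simp only: mult.assoc)
  then show ?case using Q(2) by blast
qed

end

context padic_ring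
begin

text \<open>
  A p-adically convergent power series is represented by polynomials that agree with it on larger and
  larger initial segments of the natural numbers. The shift D is the price for closure under addition
  and multiplication; since k - D is truncated, it leaves the first D coefficients unconstrained.
\<close>

definition analytic :: "(nat \<Rightarrow> 'a) \<Rightarrow> bool" where
  "analytic u \<longleftrightarrow> (\<exists>D. \<forall>n. \<exists>R. (\<forall>m\<le>n. poly R (of_nat m) = u m) \<and>
     (\<forall>k. \<exists>v\<in>V. coeff R k = of_nat p ^ (k - D) * v))"

lemma analytic_add:
  assumes "analytic u" "analytic w"
  shows "analytic (\<lambda>m. u m + w m)"
proof -
  obtain D1 where D1: "\<And>n. \<exists>R. (\<forall>m\<le>n. poly R (of_nat m) = u m) \<and>
     (\<forall>k. \<exists>v\<in>V. coeff R k = of_nat p ^ (k - D1) * v)" using assms(1) unfolding analytic_def by blast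
  obtain D2 where D2: "\<And>n. \<exists>R. (\<forall>m\<le>n. poly R (of_nat m) = w m) \<and>
     (\<forall>k. \<exists>v\<in>V. coeff R k = of_nat p ^ (k - D2) * v)" using assms(2) unfolding analytic_def by blast
  show ?thesis unfolding analytic_def
  proof (intro exI[of _ "D1 + D2"] allI)
    fix n
    obtain R where R: "\<forall>m\<le>n. poly R (of_nat m) = u m"
      "\<And>k. \<exists>v\<in>V. coeff R k = of_nat p ^ (k - D1) * v" using D1[of n] by blast
    obtain S where S: "\<forall>m\<le>n. poly S (of_nat m) = w m"
      "\<And>k. \<exists>v\<in>V. coeff S k = of_nat p ^ (k - D2) * v" using D2[of n] by blast
    have "\<exists>v\<in>V. coeff (R + S) k = of_nat p ^ (k - (D1 + D2)) * v" for k
    proof -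
      obtain v v' where v: "v \<in> V" "coeff R k = of_nat p ^ (k - D1) * v" 
          "v' \<in> V" "coeff S k = of_nat p ^ (k - D2) * v'" using R(2) S(2) by blast
      have e: "k - D1 = (k - (D1 + D2)) + ((k - D1) - (k - (D1 + D2)))"
        "k - D2 = (k - (D1 + D2)) + ((k - D2) - (k - (D1 + D2)))" by auto
      have "coeff (R + S) k = of_nat p ^ (k - (D1 + D2)) *
          (of_nat p ^ ((k - D1) - (k - (D1 + D2))) * v + of_nat p ^ ((k - D2) - (k - (D1 + D2))) * v')"
        by (simp only: coeff_add v distrib_left mult.assoc[symmetric] power_add[symmetric] e[symmetric])
      moreover have "of_nat p ^ ((k - D1) - (k - (D1 + D2))) * v + of_nat p ^ ((k - D2) - (k - (D1 + D2))) * v' \<in> V"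
        using v by simp
      ultimately show ?thesis by blast
    qed
    then show "\<exists>R. (\<forall>m\<le>n. poly R (of_nat m) = u m + w m) \<and>
        (\<forall>k. \<exists>v\<in>V. coeff R k = of_nat p ^ (k - (D1 + D2)) * v)"
      using R(1) S(1) by (intro exI[of _ "R + S"]) simp
  qed
qed

lemma analytic_mult:
  assumes "analytic u" "analytic w"
  shows "analytic (\<lambda>m. u m * w m)"
proof -
  obtain D1 where D1: "\<And>n. \<exists>R. (\<forall>m\<le>n. poly R (of_nat m) = u m) \<and>
     (\<forall>k. \<exists>v\<in>V. coeff R k = of_nat p ^ (k - D1) * v)" using assms(1) unfolding analytic_def by blast
  obtain D2 where D2: "\<And>n. \<exists>R. (\<forall>m\<le>n. poly R (of_nat m) = w m) \<and>
     (\<forall>k. \<exists>v\<in>V. coeff R k = of_nat p ^ (k - D2) * v)" using assms(2) unfolding analytic_def by blast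
  show ?thesis unfolding analytic_def
  proof (intro exI[of _ "D1 + D2"] allI)
    fix n
    obtain R where R: "\<forall>m\<le>n. poly R (of_nat m) = u m"
      "\<And>k. \<exists>v\<in>V. coeff R k = of_nat p ^ (k - D1) * v" using D1[of n] by blast
    obtain S where S: "\<forall>m\<le>n. poly S (of_nat m) = w m"
      "\<And>k. \<exists>v\<in>V. coeff S k = of_nat p ^ (k - D2) * v" using D2[of n] by blast
    obtain r where r: "\<And>k. r k \<in> V" "\<And>k. coeff R k = of_nat p ^ (k - D1) * r k"
      using R(2) by metis
    obtain s where s: "\<And>k. s k \<in> V" "\<And>k. coeff S k = of_nat p ^ (k - D2) * s k"
      using S(2) by metis
    have "\<exists>v\<in>V. coeff (R * S) k = of_nat p ^ (k - (D1 + D2)) * v" for k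
    proof -
      \<comment> \<open>the surplus of the product over the required power of p; truncation only helps\<close>
      define e where "e i = (i - D1) + (k - i - D2) - (k - (D1 + D2))" for i
      have e: "(i - D1) + (k - i - D2) = (k - (D1 + D2)) + e i" if "i \<le> k" for i
        unfolding e_def using that by auto
      have "coeff (R * S) k = (\<Sum>i\<le>k. of_nat p ^ (k - (D1 + D2)) * (of_nat p ^ e i * (r i * s (k - i))))"
        unfolding coeff_mult
      proof (rule sum.cong)
        fix i assume "i \<in> {..k}"
        then have "i \<le> k" by simp
        have "coeff R i * coeff S (k - i) = of_nat p ^ ((i - D1) + (k - i - D2)) * (r i * s (k - i))"
          by (simp add: r s power_add mult_ac)
        also have "\<dots> = of_nat p ^ (k - (D1 + D2)) * (of_nat p ^ e i * (r i * s (k - i)))"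
          unfolding e[OF \<open>i \<le> k\<close>] by (simp add: power_add mult_ac)
        finally show "coeff R i * coeff S (k - i) =
            of_nat p ^ (k - (D1 + D2)) * (of_nat p ^ e i * (r i * s (k - i)))" .
      qed simp
      also have "\<dots> = of_nat p ^ (k - (D1 + D2)) * (\<Sum>i\<le>k. of_nat p ^ e i * (r i * s (k - i)))"
        by (simp add: sum_distrib_left)
      finally show ?thesis using r s by (intro bexI) (assumption, simp)
    qed
    then show "\<exists>R. (\<forall>m\<le>n. poly R (of_nat m) = u m * w m) \<and>
        (\<forall>k. \<exists>v\<in>V. coeff R k = of_nat p ^ (k - (D1 + D2)) * v)"
      using R(1) S(1) by (intro exI[of _ "R * S"]) simp
  qed
qed

lemma analytic_poly:
  assumes "f \<in> polys_over V"
  shows "analytic (\<lambda>m. poly f (of_nat m))"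
  unfolding analytic_def
proof (intro exI[of _ "degree f"] allI exI[of _ f] conjI impI refl)
  fix k
  show "\<exists>v\<in>V. coeff f k = of_nat p ^ (k - degree f) * v"
  proof (cases "k \<le> degree f")
    case True
    then show ?thesis using assms by (intro bexI[of _ "coeff f k"]) (auto simp: polys_over_def)
  next
    case False
    then show ?thesis by (intro bexI[of _ 0]) (auto simp: coeff_eq_0)
  qed
qed

lemma analytic_const: "c \<in> V \<Longrightarrow> analytic (\<lambda>m. c)"
  using analytic_poly[of "[:c:]"] by simp

text \<open>
  The part of n! prime to p is a unit of V, and the power of p in n! is at most n.
\<close>

lemma p_power_over_fact_in: "of_nat p ^ n / fact n \<in> V"
proof -
  obtain u where u: "\<not> p dvd u" "fact n dvd p ^ n * u"
    using fact_dvd_prime_power[OF prime_p] by blast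
  then obtain w where w: "p ^ n * u = fact n * w" by (auto elim: dvdE)
  have inv: "inverse (of_int (int u)) \<in> V" using u(1) by (intro inverse_of_int_in) simp
  have "u \<noteq> 0" using u(1) by (metis dvd_0_right)
  have "of_nat p ^ n * of_nat u = (fact n * of_nat w :: 'a)"
    using arg_cong[OF w, of "of_nat :: nat \<Rightarrow> 'a"] by (simp only: of_nat_mult of_nat_power of_nat_fact)
  then have "of_nat p ^ n / fact n = of_nat w * inverse (of_int (int u) :: 'a)"
    using \<open>u \<noteq> 0\<close> by (simp add: field_simps)
  also have "\<dots> \<in> V" using inv by simp
  finally show ?thesis .
qed

text \<open>
  The interpolating polynomials are truncations of the binomial series of (1 + p^2 v)^m, written with
  falling factorials, which have integer coefficients.
\<close>

lemma analytic_power: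
  assumes "v \<in> V"
  shows "analytic (\<lambda>m. (1 + of_nat p ^ 2 * v) ^ m)"
  unfolding analytic_def
proof (intro exI[of _ "0::nat"] allI)
  fix n :: nat
  define F :: "nat \<Rightarrow> 'a poly" where "F i = (\<Prod>j=0..<i. [:- of_nat j, 1:])" for i
  define c where "c i = (of_nat p ^ 2 * v) ^ i / fact i" for i
  define R where "R = (\<Sum>i\<le>n. smult (c i) (F i))"
  have F: "F i \<in> polys_over V" for i unfolding F_def by simp
  have F_poly: "poly (F i) (of_nat m) / fact i = of_nat (m choose i)" for i m
    unfolding F_def by (simp add: poly_prod gbinomial_prod_rev[symmetric] binomial_gbinomial)
  have "poly R (of_nat m) = (1 + of_nat p ^ 2 * v) ^ m" if "m \<le> n" for m
  proof -
    have "poly R (of_nat m) = (\<Sum>i\<le>n. of_nat (m choose i) * (of_nat p ^ 2 * v) ^ i)"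
      unfolding R_def poly_sum by (rule sum.cong) (auto simp: c_def F_poly[symmetric])
    also have "\<dots> = (\<Sum>i\<le>m. of_nat (m choose i) * (of_nat p ^ 2 * v) ^ i)"
      using that by (intro sum.mono_neutral_right) auto
    also have "\<dots> = (of_nat p ^ 2 * v + 1) ^ m" by (subst binomial_ring) simp
    finally show ?thesis by (simp add: add.commute)
  qed
  moreover have "\<exists>v\<in>V. coeff R k = of_nat p ^ (k - 0) * v" for k
  proof -
    \<comment> \<open>For i \<ge> k, split p^(2 i) / i! as p^k p^(i - k) (p^i / i!); for i < k, the i-th falling
      factorial has degree below k and contributes nothing.\<close>
    define d where "d i = (if i < k then 0 else of_nat p ^ (i - k) * (of_nat p ^ i / fact i) * v ^ i * coeff (F i) k)" for i
    have d: "d i \<in> V" for i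
      unfolding d_def using F[of i] assms p_power_over_fact_in[of i] by (auto simp: polys_over_def simp del: times_divide_eq_right)
    have "c i * coeff (F i) k = of_nat p ^ k * d i" for i
    proof (cases "i < k")
      case True
      have "degree (F i) \<le> i" unfolding F_def by (rule order.trans[OF degree_prod_sum_le]) auto
      then show ?thesis using True by (simp add: d_def coeff_eq_0)
    next
      case False
      then have "(of_nat p ^ 2) ^ i = of_nat p ^ k * of_nat p ^ (i - k) * (of_nat p ^ i :: 'a)"
        by (simp flip: power_add power_mult) (simp add: mult_2)
      then show ?thesis using False by (simp add: d_def c_def power_mult_distrib)
    qed
    then have "coeff R k = of_nat p ^ k * (\<Sum>i\<le>n. d i)"
      by (simp add: R_def coeff_sum sum_distrib_left)
    then show ?thesis using d by (intro bexI[of _ "\<Sum>i\<le>n. d i"]) simp_all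
  qed
  ultimately show "\<exists>R. (\<forall>m\<le>n. poly R (of_nat m) = (1 + of_nat p ^ 2 * v) ^ m) \<and>
      (\<forall>k. \<exists>v\<in>V. coeff R k = of_nat p ^ (k - 0) * v)" by blast
qed

text \<open>
  Hansel's argument. A polynomial that interpolates u up to m and up to k + D of its zeros is divisible
  by k + D linear factors with integer roots, and the cofactor has all its coefficients in p^k V.
\<close>

lemma analytic_zero:
  assumes "analytic u" "infinite {m. u m = 0}"
  shows "u m = 0"
proof (rule not_divisible_by_all_p_powers)
  obtain D where D: "\<And>n. \<exists>R. (\<forall>m\<le>n. poly R (of_nat m) = u m) \<and>
     (\<forall>k. \<exists>v\<in>V. coeff R k = of_nat p ^ (k - D) * v)" using assms(1) unfolding analytic_def by blast
  show *: "\<exists>v\<in>V. u m = of_nat p ^ k * v" for k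
  proof -
    obtain Z where Z: "finite Z" "card Z = k + D" "Z \<subseteq> {m. u m = 0}"
      using infinite_arbitrarily_large[OF assms(2)] by blast
    define n where "n = Max (insert m Z)"
    have n: "m \<le> n" "\<And>z. z \<in> Z \<Longrightarrow> z \<le> n" unfolding n_def using Z(1) by auto
    obtain R where R: "\<forall>m\<le>n. poly R (of_nat m) = u m"
      "\<And>k. \<exists>v\<in>V. coeff R k = of_nat p ^ (k - D) * v" using D[of n] by blast
    define Z' where "Z' = (of_nat ` Z :: 'a set)"
    have Z': "finite Z'" "card Z' = k + D" "\<forall>z\<in>Z'. z \<in> V" "\<forall>z\<in>Z'. poly R z = 0"
      unfolding Z'_def using Z R(1) n by (auto simp: card_image inj_on_def)
    have "\<forall>j\<ge>card Z'. \<exists>v\<in>V. coeff R j = of_nat p ^ k * v"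
    proof (intro allI impI)
      fix j assume "j \<ge> card Z'"
      then have "j - D = k + (j - D - k)" unfolding Z'(2) by simp
      moreover obtain v where "v \<in> V" "coeff R j = of_nat p ^ (j - D) * v" using R(2) by blast
      ultimately show "\<exists>v\<in>V. coeff R j = of_nat p ^ k * v"
        by (intro bexI[of _ "of_nat p ^ (j - D - k) * v"]) (simp_all flip: power_add mult.assoc)
    qed
    from quotient_by_roots[OF Z'(1,3,4) this] obtain Q where Q:
      "R = (\<Prod>z\<in>Z'. [:- z, 1:]) * Q" "\<forall>j. \<exists>v\<in>V. coeff Q j = of_nat p ^ k * v" by blast
    obtain q where q: "\<And>j. q j \<in> V" "\<And>j. coeff Q j = of_nat p ^ k * q j" using Q(2) by metis
    have "poly Q (of_nat m) = of_nat p ^ k * (\<Sum>i\<le>degree Q. q i * of_nat m ^ i)"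
      by (simp add: poly_altdef q(2) sum_distrib_left mult_ac)
    moreover have "u m = poly (\<Prod>z\<in>Z'. [:- z, 1:]) (of_nat m) * poly Q (of_nat m)"
      using R(1) n(1) Q(1) by (metis poly_mult)
    ultimately have "u m = of_nat p ^ k *
        (poly (\<Prod>z\<in>Z'. [:- z, 1:]) (of_nat m) * (\<Sum>i\<le>degree Q. q i * of_nat m ^ i))"
      by (simp add: mult_ac)
    moreover have "poly (\<Prod>z\<in>Z'. [:- z, 1:]) (of_nat m) * (\<Sum>i\<le>degree Q. q i * of_nat m ^ i) \<in> V"
      using q(1) Z'(3) by (intro mult_in poly_in polys_over_prod sum_in) auto
    ultimately show ?thesis by blast
  qed
  from *[of 0] show "u m \<in> K" using V_subset by auto
qed

end

section \<open>Localisation, and the rational numbers\<close>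

text \<open>
  Elements that are congruent to members of T do not enlarge the quotient ring. In the extension
  steps below this is how a finite quotient ring of the old ring V serves for the new one.
\<close>

lemma (in subring_set) closed_mod_extend:
  assumes "closed_mod c W T" "W \<subseteq> V" "c \<in> V" "Y \<subseteq> V"
    and Y: "\<And>y. y \<in> Y \<Longrightarrow> \<exists>t\<in>T. \<exists>v\<in>V. y = t + c * v"
  shows "closed_mod c V (Y \<union> T)"
proof -
  have T: "T \<subseteq> W" and
    T_add: "\<And>x y. x \<in> T \<Longrightarrow> y \<in> T \<Longrightarrow> \<exists>z\<in>T. \<exists>v\<in>W. x + y = z + c * v" and
    T_mult: "\<And>x y. x \<in> T \<Longrightarrow> y \<in> T \<Longrightarrow> \<exists>z\<in>T. \<exists>v\<in>W. x * y = z + c * v"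
    using assms(1) unfolding closed_mod_def by blast+
  have rep: "\<exists>t\<in>T. \<exists>v\<in>V. x = t + c * v" if "x \<in> Y \<union> T" for x
  proof (cases "x \<in> Y")
    case False
    moreover have "x = x + c * 0" by simp
    ultimately show ?thesis using that zero_in by blast
  qed (rule Y)
  show ?thesis unfolding closed_mod_def
  proof (intro conjI ballI)
    show "Y \<union> T \<subseteq> V" using assms T by blast
  next
    fix x y assume xy: "x \<in> Y \<union> T" "y \<in> Y \<union> T"
    obtain s u where s: "s \<in> T" "u \<in> V" "x = s + c * u" using rep[OF xy(1)] by blast
    obtain t v where t: "t \<in> T" "v \<in> V" "y = t + c * v" using rep[OF xy(2)] by blast
    have ST: "s \<in> V" "t \<in> V" using s(1) t(1) T assms(2) by auto
    obtain z w where z: "z \<in> T" "w \<in> W" "s + t = z + c * w" using T_add[OF s(1) t(1)] by blast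
    have "x + y = z + c * (w + u + v)" using s t z by (simp add: algebra_simps)
    moreover have "w + u + v \<in> V" using s t z assms(2) by (auto simp: subset_iff)
    ultimately show "\<exists>z\<in>Y \<union> T. \<exists>v\<in>V. x + y = z + c * v" using z(1) by blast
    obtain z w where z: "z \<in> T" "w \<in> W" "s * t = z + c * w" using T_mult[OF s(1) t(1)] by blast
    have "x * y = s * t + c * (u * t + s * v + c * (u * v))" using s t by (simp add: algebra_simps)
    also have "\<dots> = z + c * (w + (u * t + s * v + c * (u * v)))" using z(3) by (simp add: algebra_simps)
    finally have "x * y = z + c * (w + (u * t + s * v + c * (u * v)))" .
    moreover have "w + (u * t + s * v + c * (u * v)) \<in> V"
      using s t z assms(2,3) ST by (auto simp: subset_iff)
    ultimately show "\<exists>z\<in>Y \<union> T. \<exists>v\<in>V. x * y = z + c * v" using z(1) by blast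
  qed
qed

lemma (in residual_ring) one_plus_p_nonzero:
  assumes "x \<in> V"
  shows "1 + of_nat p * x \<noteq> 0"
proof
  assume "1 + of_nat p * x = 0"
  then have "of_nat p * (- x) = 1" by (simp add: add_eq_0_iff2)
  then have "inverse (of_nat p) = - x" by (rule inverse_unique)
  then show False using p_not_unit assms by simp
qed

text \<open>
  Inverting 1 + pV does not change anything modulo p: u / (1 + p w) is congruent to u.
\<close>

lemma (in residual_ring) padic_ring_localisation:
  "\<exists>W. V \<subseteq> W \<and> padic_ring p K W"
proof -
  define W where "W = {u * inverse (1 + of_nat p * w) | u w. u \<in> V \<and> w \<in> V}"
  have WI: "u * inverse (1 + of_nat p * w) \<in> W" if "u \<in> V" "w \<in> V" for u w
    using that unfolding W_def by blast
  have WI': "y \<in> W" if "u \<in> V" "w \<in> V" "y * (1 + of_nat p * w) = u" for y u w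
  proof -
    have "y = u * inverse (1 + of_nat p * w)"
      using that(3)[symmetric] one_plus_p_nonzero[OF that(2)] by simp
    then show ?thesis using WI that by simp
  qed
  have WE: "\<exists>u w. u \<in> V \<and> w \<in> V \<and> y * (1 + of_nat p * w) = u" if "y \<in> W" for y
    using that one_plus_p_nonzero unfolding W_def by fastforce
  have V_W: "V \<subseteq> W"
  proof
    fix x assume "x \<in> V"
    then show "x \<in> W" by (intro WI'[of x 0]) simp_all
  qed
  interpret W: subring_set W
  proof
    show "1 \<in> W" using V_W by auto
  next
    fix x y assume "x \<in> W" "y \<in> W"
    then obtain u w u' w' where u: "u \<in> V" "w \<in> V" "x * (1 + of_nat p * w) = u"
      "u' \<in> V" "w' \<in> V" "y * (1 + of_nat p * w') = u'" using WE by meson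
    \<comment> \<open>the common denominator: 1 + p w2 is the product of the two given ones\<close>
    define w2 where "w2 = w + w' + of_nat p * (w * w')"
    have w2: "w2 \<in> V" "1 + of_nat p * w2 = (1 + of_nat p * w) * (1 + of_nat p * w')"
      using u by (simp_all add: w2_def algebra_simps)
    have "(x - y) * (1 + of_nat p * w2) = u * (1 + of_nat p * w') - u' * (1 + of_nat p * w)"
      unfolding w2(2) u(3,6)[symmetric] by (simp add: algebra_simps)
    then show "x - y \<in> W" using u w2(1) by (intro WI'[OF _ w2(1)]) simp_all
    have "(x * y) * (1 + of_nat p * w2) = u * u'"
      unfolding w2(2) u(3,6)[symmetric] by (simp add: algebra_simps)
    then show "x * y \<in> W" using u w2(1) by (intro WI'[OF _ w2(1)]) simp_all
  qed
  have "padic_ring p K W"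
  proof
    show "prime p" by (rule prime_p)
    show "x \<in> K \<Longrightarrow> inverse x \<in> K" for x by (rule inverse_K)
    show "W \<subseteq> K" unfolding W_def using V_subset by (auto intro!: K.mult_in inverse_K K.add_in)
    show "\<exists>s. of_nat p ^ s * x \<in> W" if "x \<in> K" for x
      using p_denominator[OF that] V_W by blast
    show "inverse (of_nat p) \<notin> W"
    proof
      assume "inverse (of_nat p) \<in> W"
      from WE[OF this] obtain u w where u: "u \<in> V" "w \<in> V" "inverse (of_nat p) * (1 + of_nat p * w) = u"
        by (elim exE conjE) (rule that)
      have "inverse (of_nat p) * (1 + of_nat p * w) = inverse (of_nat p) + w"
        by (simp add: distrib_left left_inverse flip: mult.assoc)
      then have "inverse (of_nat p) = u - w" using u(3) by simp
      then show False using p_not_unit u by simp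
    qed
    show "inverse (1 + of_nat p * x) \<in> W" if x: "x \<in> W" for x
    proof -
      obtain u w where u: "u \<in> V" "w \<in> V" "x * (1 + of_nat p * w) = u" using WE[OF x] by (elim exE conjE) (rule that)
      have e: "1 + of_nat p * (w + u) = (1 + of_nat p * x) * (1 + of_nat p * w)"
        unfolding u(3)[symmetric] by (simp add: algebra_simps)
      have "1 + of_nat p * (w + u) \<noteq> 0" using one_plus_p_nonzero u by simp
      then have "1 + of_nat p * x \<noteq> 0" unfolding e by simp
      then have "inverse (1 + of_nat p * x) * (1 + of_nat p * (w + u)) = 1 + of_nat p * w"
        unfolding e by (simp only: mult.assoc[symmetric] left_inverse mult_1_left simp_thms)
      then show ?thesis using u by (intro WI'[of "1 + of_nat p * w" "w + u"]) simp_all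
    qed
    show "\<exists>T. finite T \<and> Y \<subseteq> T \<and> closed_mod (of_nat p) W T" if Y: "finite Y" "Y \<subseteq> W" for Y
    proof -
      have "\<forall>y\<in>Y. \<exists>u\<in>V. \<exists>w\<in>V. y * (1 + of_nat p * w) = u" using WE Y(2) by (meson subsetD)
      then obtain u w where u: "\<And>y. y \<in> Y \<Longrightarrow> u y \<in> V" "\<And>y. y \<in> Y \<Longrightarrow> w y \<in> V"
        "\<And>y. y \<in> Y \<Longrightarrow> y * (1 + of_nat p * w y) = u y" by metis
      have "finite (u ` Y)" "u ` Y \<subseteq> V" using Y u by auto
      then obtain T where T: "finite T" "u ` Y \<subseteq> T" "closed_mod (of_nat p) V T"
        by (meson residues_finite)
      have "closed_mod (of_nat p) W (Y \<union> T)"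
      proof (rule W.closed_mod_extend[OF T(3) V_W])
        fix y assume "y \<in> Y"
        have "y = u y + of_nat p * (- (y * w y))"
          unfolding u(3)[OF \<open>y \<in> Y\<close>, symmetric] by (simp add: algebra_simps)
        moreover have "- (y * w y) \<in> W" using u \<open>y \<in> Y\<close> Y(2) V_W by (auto simp: subset_iff)
        ultimately show "\<exists>t\<in>T. \<exists>v\<in>W. y = t + of_nat p * v" using T(2) \<open>y \<in> Y\<close> by blast
      qed (use Y in auto)
      then show ?thesis using T(1) Y(1) by (intro exI[of _ "Y \<union> T"]) auto
    qed
  qed
  then show ?thesis using V_W by blast
qed

text \<open>
  The localisation of the integers at p, with residue ring represented by 0, ..., p - 1.
\<close>

lemma padic_ring_Rats:
  assumes "prime p"
  shows "padic_ring p (\<rat> :: 'a::field_char_0 set) {of_int a / of_int b | a b. \<not> int p dvd b}"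
proof -
  define V where "V = {of_int a / of_int b :: 'a | a b. \<not> int p dvd b}"
  have p: "prime (int p)" using assms by simp
  have VI: "of_int a / of_int b \<in> V" if "\<not> int p dvd b" for a b using that unfolding V_def by blast
  have VE: "\<exists>a b. \<not> int p dvd b \<and> b \<noteq> 0 \<and> x = of_int a / of_int b" if "x \<in> V" for x
    using that dvd_0_right unfolding V_def by blast
  interpret V: subring_set V
  proof
    have "\<not> int p dvd 1" using p not_prime_unit by blast
    then show "1 \<in> V" using VI[of 1 1] by simp
  next
    fix x y assume "x \<in> V" "y \<in> V"
    then obtain a b c d where *: "\<not> int p dvd b" "b \<noteq> 0" "x = of_int a / of_int b"
      "\<not> int p dvd d" "d \<noteq> 0" "y = of_int c / of_int d" using VE by meson
    then have "\<not> int p dvd b * d" using p by (simp add: prime_dvd_mult_iff)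
    from VI[OF this, of "a * d - c * b"] VI[OF this, of "a * c"]
    show "x - y \<in> V" "x * y \<in> V" using * by (simp_all add: diff_frac_eq)
  qed
  have "padic_ring p \<rat> V"
  proof
    show "prime p" by (rule assms)
    show "(1::'a) \<in> \<rat>" by simp
    show "x \<in> \<rat> \<Longrightarrow> y \<in> \<rat> \<Longrightarrow> x - y \<in> \<rat>" for x y :: 'a by (rule Rats_diff)
    show "x \<in> \<rat> \<Longrightarrow> y \<in> \<rat> \<Longrightarrow> x * y \<in> \<rat>" for x y :: 'a by (rule Rats_mult)
    show "x \<in> \<rat> \<Longrightarrow> inverse x \<in> \<rat>" for x :: 'a by (rule Rats_inverse)
    show "V \<subseteq> \<rat>" unfolding V_def by auto
    show "\<exists>s. of_nat p ^ s * x \<in> V" if x: "x \<in> \<rat>" for x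
    proof -
      obtain a b where ab: "b > 0" "x = of_int a / of_int b" using x by (auto elim!: Rats_cases')
      have "\<not> is_unit (int p)" using p not_prime_unit by blast
      then obtain b' where b': "b = int p ^ multiplicity (int p) b * b'" "\<not> int p dvd b'"
        using ab(1) multiplicity_decompose'[of b "int p"] by force
      have "int p \<noteq> 0" using p by auto
      have "(of_int b :: 'a) = of_nat p ^ multiplicity (int p) b * of_int b'"
        by (subst b'(1)) simp
      moreover have "of_nat p \<noteq> (0::'a)" using \<open>int p \<noteq> 0\<close> by simp
      ultimately have "of_nat p ^ multiplicity (int p) b * x = of_int a / of_int b'"
        unfolding ab(2) by simp
      then show ?thesis using VI[OF b'(2), of a] by (intro exI[of _ "multiplicity (int p) b"]) simp
    qed
    show "inverse (of_nat p) \<notin> V"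
    proof
      assume "inverse (of_nat p) \<in> V"
      from VE[OF this] obtain a b where ab: "\<not> int p dvd b" "b \<noteq> 0" "inverse (of_nat p) = (of_int a / of_int b :: 'a)"
        by (elim exE conjE) (rule that)
      have "p > 0" using assms prime_gt_0_nat by blast
      then have "(of_int b :: 'a) = of_int (int p * a)" using ab(2,3) by (simp add: field_simps)
      then have "b = int p * a" by (simp only: of_int_eq_iff)
      then show False using ab(1) by simp
    qed
    show "inverse (1 + of_nat p * x) \<in> V" if x: "x \<in> V" for x
    proof -
      obtain a b where ab: "\<not> int p dvd b" "b \<noteq> 0" "x = of_int a / of_int b" using VE[OF x] by (elim exE conjE) (rule that)
      have "\<not> int p dvd b + int p * a" using ab(1) by (metis dvd_add_left_iff dvd_triv_left)
      from VI[OF this, of b] have m: "of_int b / of_int (b + int p * a) \<in> V" .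
      have "of_int (b + int p * a) = of_int b * (1 + of_nat p * x)"
        using ab by (simp add: field_simps)
      from m[unfolded this] show ?thesis using ab(2) by (simp add: inverse_eq_divide)
    qed
    show "\<exists>T. finite T \<and> Y \<subseteq> T \<and> closed_mod (of_nat p) V T" if Y: "finite Y" "Y \<subseteq> V" for Y
    proof -
      define T where "T = (of_int ` {0..<int p} :: 'a set)"
      have p0: "int p > 0" using p prime_gt_0_int by blast
      have rep: "\<exists>t\<in>T. \<exists>v\<in>V. y = t + of_nat p * v" if y: "y \<in> V" for y
      proof -
        obtain a b where ab: "\<not> int p dvd b" "b \<noteq> 0" "y = of_int a / of_int b" using VE[OF y] by (elim exE conjE) (rule that)
        have "coprime (int p) b" using p ab(1) by (rule prime_imp_coprime)
        then have "gcd b (int p) = 1" by (metis coprime_imp_gcd_eq_1 gcd.commute)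
        then obtain u w where uw: "u * b + w * int p = 1" using bezout_int[of b "int p"] by metis
        define t where "t = (a * u) mod int p"
        have "a - t * b = a * (u * b + w * int p) - t * b" unfolding uw by simp
        also have "\<dots> = (a * u - t) * b + int p * (a * w)" by (simp add: algebra_simps)
        also have "a * u - t = int p * ((a * u) div int p)" unfolding t_def by (simp add: minus_mod_eq_mult_div)
        finally have "a - t * b = int p * ((a * u) div int p * b + a * w)" by (simp add: algebra_simps)
        then obtain k where k: "a - t * b = int p * k" by blast
        have "(of_int a :: 'a) = of_int (t * b + int p * k)" using k by (simp add: algebra_simps)
        then have "y = of_int t + of_nat p * (of_int k / of_int b)"
          using ab by (simp add: field_simps)
        moreover have "of_int t \<in> T" unfolding T_def t_def using p0 by simp
        ultimately show ?thesis using VI[OF ab(1)] by blast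
      qed
      have T: "T \<subseteq> V" unfolding T_def by auto
      have "closed_mod (of_nat p) V T"
        unfolding closed_mod_def by (intro conjI ballI T rep V.add_in V.mult_in subsetD[OF T])
      then have "closed_mod (of_nat p) V (Y \<union> T)"
        using rep Y(2) by (intro V.closed_mod_extend[where W = V]) auto
      then show ?thesis using Y unfolding T_def by (intro exI[of _ "Y \<union> T"]) (auto simp: T_def)
    qed
  qed
  then show ?thesis unfolding V_def .
qed

section \<open>Algebraic extensions\<close>

definition adjoin :: "'a::field_char_0 set \<Rightarrow> 'a \<Rightarrow> 'a set" where
  "adjoin K x = {poly f x | f. f \<in> polys_over K}"

locale algebraic_extension = K: subring_set K
  for K :: "'a::field_char_0 set" +
  fixes h :: "'a poly" and x :: 'a
  assumes inverse_in: "c \<in> K \<Longrightarrow> inverse c \<in> K"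
    and h_over: "h \<in> polys_over K" and h_monic: "lead_coeff h = 1" and h_root: "poly h x = 0"
    and h_minimal: "f \<in> polys_over K \<Longrightarrow> poly f x = 0 \<Longrightarrow> degree f < degree h \<Longrightarrow> f = 0"
begin

lemma degree_h_pos: "degree h > 0"
proof (rule ccontr)
  assume "\<not> degree h > 0"
  then obtain c where "h = [:c:]" by (auto elim: degree_eq_zeroE)
  then show False using h_root h_monic by simp
qed

lemma poly_eq_imp_eq:
  assumes "f \<in> polys_over K" "g \<in> polys_over K" "degree f < degree h" "degree g < degree h"
    and "poly f x = poly g x"
  shows "f = g"
  using h_minimal[of "f - g"] assms degree_diff_less[of f "degree h" g] by simp

text \<open>
  Elements of K[x] are inverted by the Euclidean algorithm with the minimal polynomial h: dividing h by
  f leaves a remainder of smaller degree, whose value at x is a multiple of the value of f.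
\<close>

lemma ex_inverse_aux:
  assumes "f \<in> polys_over K" "f \<noteq> 0" "degree f < degree h"
  shows "\<exists>g\<in>polys_over K. poly f x * poly g x = 1"
  using assms
proof (induction "degree f" arbitrary: f rule: less_induct)
  case less
  define l where "l = inverse (lead_coeff f)"
  have l: "l \<in> K" "l \<noteq> 0" using less.prems inverse_in by (auto simp: l_def polys_over_def)
  define f1 where "f1 = smult l f"
  have f1: "f1 \<in> polys_over K" "lead_coeff f1 = 1" "degree f1 = degree f" "f1 \<noteq> 0"
    using l less.prems by (auto simp: f1_def l_def)
  show ?case
  proof (cases "degree f = 0")
    case True
    then have "poly f1 x = 1" using f1 by (metis degree_eq_zeroE lead_coeff_pCons(2) pCons_0_0 poly_pCons poly_0 mult_zero_right add_0_right)
    then show ?thesis using l by (intro bexI[of _ "[:l:]"]) (auto simp: f1_def mult.commute)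
  next
    case False
    obtain q r where q: "q \<in> polys_over K" "r \<in> polys_over K" "h = q * f1 + r" "degree r < degree f1"
      using K.monic_division[OF f1(1,2) _ h_over] False f1(3) by auto
    have 0: "poly q x * poly f1 x + poly r x = 0" using h_root unfolding q(3) by simp
    show ?thesis
    proof (cases "r = 0")
      case True
      have "poly f1 x \<noteq> 0" using h_minimal[OF f1(1)] f1 less.prems by auto
      then have "poly q x = 0" using 0 True by simp
      moreover have "degree h = degree q + degree f1"
        using q(3) True f1(4) h_monic by (metis add_0_right degree_mult_eq leading_coeff_0_iff mult_eq_0_iff zero_neq_one)
      ultimately have "q = 0" using h_minimal[OF q(1)] f1(3) False by simp
      then have "h = 0" using q(3) True by simp
      then show ?thesis using h_monic by simp
    next
      case False
      obtain g where g: "g \<in> polys_over K" "poly r x * poly g x = 1"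
        using less.hyps[of r] q False f1 less.prems(3) by auto
      have "poly f x * poly (- smult l (q * g)) x = - (poly q x * poly f1 x) * poly g x"
        by (simp add: f1_def)
      also have "\<dots> = poly r x * poly g x" using 0 by (metis add_eq_0_iff)
      finally have "poly f x * poly (0 - smult l (q * g)) x = 1" using g(2) by simp
      moreover have "0 - smult l (q * g) \<in> polys_over K"
        using q g l by (intro K.polys_over_diff K.polys_over_smult K.polys_over_mult) auto
      ultimately show ?thesis by blast
    qed
  qed
qed

lemma inverse_adjoin:
  assumes "y \<in> adjoin K x"
  shows "inverse y \<in> adjoin K x"
proof (cases "y = 0")
  case False
  obtain f where f: "f \<in> polys_over K" "y = poly f x" using assms by (auto simp: adjoin_def)
  obtain q r where q: "r \<in> polys_over K" "f = q * h + r" "degree r < degree h"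
    using K.monic_division[OF h_over h_monic degree_h_pos f(1)] by blast
  then have "y = poly r x" using f(2) h_root by simp
  moreover have "r \<noteq> 0" using False calculation by auto
  then obtain g where "g \<in> polys_over K" "poly r x * poly g x = 1"
    using ex_inverse_aux[OF q(1) _ q(3)] by blast
  ultimately show ?thesis unfolding adjoin_def using inverse_unique by blast
qed (use assms in simp)

end

lemma (in subring_set) subring_adjoin: "subring_set (adjoin V x)"
proof
  show "1 \<in> adjoin V x" unfolding adjoin_def using polys_over_1 by (metis (mono_tags, lifting) mem_Collect_eq poly_1)
  fix y z assume "y \<in> adjoin V x" "z \<in> adjoin V x"
  then obtain f g where "f \<in> polys_over V" "y = poly f x" "g \<in> polys_over V" "z = poly g x"
    by (auto simp: adjoin_def)
  then have "f - g \<in> polys_over V" "y - z = poly (f - g) x" "f * g \<in> polys_over V" "y * z = poly (f * g) x"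
    by simp_all
  then show "y - z \<in> adjoin V x" "y * z \<in> adjoin V x"
    unfolding adjoin_def by blast+
qed

locale algebraic_padic_extension = algebraic_extension K h x + base: residual_ring p K V
  for p :: nat and K V :: "'a::field_char_0 set" and h x +
  assumes h_integral: "h \<in> polys_over V"
begin

lemma V_poly_K: "polys_over V \<subseteq> polys_over K"
  using base.V_subset by (rule polys_over_mono)

text \<open>
  If T0 represents a finite ring modulo p that contains the coefficients of h, then the polynomials in
  x of degree less than that of h with coefficients in T0 represent a finite ring as well: x^d can be
  rewritten by h, and the new coefficients are brought back to T0 modulo p.
\<close>

lemma residues_adjoin:
  assumes Y: "finite Y" "Y \<subseteq> adjoin V x"
  shows "\<exists>T. finite T \<and> Y \<subseteq> T \<and> closed_mod (of_nat p) (adjoin V x) T"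
proof -
  interpret W: subring_set "adjoin V x" by (rule base.subring_adjoin)
  define d where "d = degree h"
  have d: "d > 0" unfolding d_def by (rule degree_h_pos)
  have "\<forall>y\<in>Y. \<exists>f\<in>polys_over V. y = poly f x" using Y(2) by (auto simp: adjoin_def)
  then obtain F where F: "\<And>y. y \<in> Y \<Longrightarrow> F y \<in> polys_over V" "\<And>y. y \<in> Y \<Longrightarrow> y = poly (F y) x"
    by metis
  define Y0 where "Y0 = {0, 1} \<union> (\<lambda>c. - c) ` range (coeff h) \<union> (\<Union>y\<in>Y. range (coeff (F y)))"
  have "finite Y0" unfolding Y0_def using Y(1) finite_coeffs by auto
  moreover have "Y0 \<subseteq> V" unfolding Y0_def using F(1) h_integral by (auto simp: polys_over_def)
  ultimately obtain T0 where T0: "finite T0" "Y0 \<subseteq> T0" "closed_mod (of_nat p) V T0"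
    by (meson base.residues_finite)
  have T0_V: "T0 \<subseteq> V" and
    T0_add: "\<And>x y. x \<in> T0 \<Longrightarrow> y \<in> T0 \<Longrightarrow> \<exists>z\<in>T0. \<exists>v\<in>V. x + y = z + of_nat p * v" and
    T0_mult: "\<And>x y. x \<in> T0 \<Longrightarrow> y \<in> T0 \<Longrightarrow> \<exists>z\<in>T0. \<exists>v\<in>V. x * y = z + of_nat p * v"
    using T0(3) unfolding closed_mod_def by blast+
  have T0_0: "0 \<in> T0" "1 \<in> T0" using T0(2) by (auto simp: Y0_def)
  define B where "B = {f \<in> polys_over T0. degree f < d}"
  define T where "T = (\<lambda>f. poly f x) ` B"
  have "finite T" unfolding T_def B_def using T0(1) by (intro finite_imageI finite_polys_over_bounded)
  have WI: "poly f x \<in> adjoin V x" if "f \<in> polys_over V" for f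
    using that by (auto simp: adjoin_def)
  have x_W: "x \<in> adjoin V x" using WI[of "[:0, 1:]"] by simp
  have V_W: "c \<in> adjoin V x" if "c \<in> V" for c using WI[of "[:c:]"] that by simp
  define rep where "rep y \<longleftrightarrow> (\<exists>f\<in>B. \<exists>v\<in>adjoin V x. y = poly f x + of_nat p * v)" for y
  have repE: thesis if "rep y" "\<And>f v. f \<in> B \<Longrightarrow> v \<in> adjoin V x \<Longrightarrow> y = poly f x + of_nat p * v \<Longrightarrow> thesis"
    for y thesis using that unfolding rep_def by (elim bexE)
  have rep_trans: "rep y" if z: "rep z" and v: "v \<in> adjoin V x" "y = z + of_nat p * v" for y z v
  proof -
    obtain f w where "f \<in> B" "w \<in> adjoin V x" "z = poly f x + of_nat p * w" using z by (rule repE)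
    then show ?thesis unfolding rep_def
      using v by (intro bexI[of _ f] bexI[of _ "w + v"]) (simp_all add: algebra_simps)
  qed
  have rep_coeffs: "rep (poly g x)"
    if g: "degree g < d" "\<And>i::nat. \<exists>t\<in>T0. \<exists>v\<in>V. coeff g i = t + of_nat p * v" for g
  proof -
    obtain t v where t: "\<And>i. t i \<in> T0" "\<And>i. v i \<in> V" "\<And>i. coeff g i = t i + of_nat p * v i"
      using g(2) by metis
    define f where "f = Poly (map t [0..<d])"
    define e where "e = Poly (map v [0..<d])"
    have cf: "coeff f i = (if i < d then t i else 0)" for i
      unfolding f_def by (simp add: coeff_Poly_eq nth_default_def)
    have ce: "coeff e i = (if i < d then v i else 0)" for i
      unfolding e_def by (simp add: coeff_Poly_eq nth_default_def)
    have "f \<in> polys_over T0" using t(1) T0_0 by (simp add: polys_over_def cf)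
    moreover have "degree f < d" using d by (intro degree_lessI) (simp_all add: cf)
    moreover have "e \<in> polys_over V" using t(2) by (simp add: polys_over_def ce)
    moreover have "g = f + smult (of_nat p) e"
    proof (rule poly_eqI)
      show "coeff g i = coeff (f + smult (of_nat p) e) i" for i
        using g(1) coeff_eq_0[of g i] by (cases "i < d") (simp_all add: cf ce t(3))
    qed
    ultimately show ?thesis unfolding rep_def B_def using WI[of e]
      by (intro bexI[of _ f] bexI[of _ "poly e x"]) auto
  qed
  have T0_self: "\<exists>t\<in>T0. \<exists>v\<in>V. c = t + of_nat p * v" if "c \<in> T0" for c
    using that by (intro bexI[of _ c] bexI[of _ 0]) simp_all
  have rep_T0: "rep c" if "c \<in> T0" for c
    using rep_coeffs[of "[:c:]"] that d T0_self T0_0 by (simp add: coeff_pCons split: nat.split)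
  have rep_add: "rep (y + z)" if y: "rep y" and z: "rep z" for y z
  proof -
    obtain f v where f: "f \<in> B" "v \<in> adjoin V x" "y = poly f x + of_nat p * v" using y by (rule repE)
    obtain g w where g: "g \<in> B" "w \<in> adjoin V x" "z = poly g x + of_nat p * w" using z by (rule repE)
    note * = f g
    have "rep (poly (f + g) x)"
      using * T0_add by (intro rep_coeffs degree_add_less) (auto simp: B_def polys_over_def)
    then show ?thesis using * by (elim rep_trans[of _ "v + w"]) (simp_all add: algebra_simps)
  qed
  have rep_scale: "rep (c * y)" if c: "c \<in> T0" and y: "rep y" for c y
  proof -
    obtain f v where *: "f \<in> B" "v \<in> adjoin V x" "y = poly f x + of_nat p * v"
      using y by (rule repE)
    have "rep (poly (smult c f) x)"
      using * T0_mult c le_less_trans[OF degree_smult_le[of c f]]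
      by (intro rep_coeffs) (auto simp: B_def polys_over_def)
    then show ?thesis using * c T0_V V_W
      by (elim rep_trans[of _ "c * v"]) (auto simp: algebra_simps)
  qed
  have rep_x: "rep (x * y)" if y: "rep y" for y
  proof -
    obtain f v where *: "f \<in> B" "v \<in> adjoin V x" "y = poly f x + of_nat p * v"
      using y by (rule repE)
    define c where "c = coeff f (d - 1)"
    \<comment> \<open>x f(x), with its term of degree d removed by means of h\<close>
    define g where "g = pCons 0 f - smult c h"
    have fT: "coeff f i \<in> T0" for i using *(1) by (auto simp: B_def polys_over_def)
    have "rep (poly g x)"
    proof (rule rep_coeffs)
      show "degree g < d"
      proof (rule degree_lessI)
        show "\<forall>k\<ge>d. coeff g k = 0"
        proof (intro allI impI)
          fix k assume "k \<ge> d"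
          then consider "k = d" | "k > d" by linarith
          then show "coeff g k = 0"
          proof cases
            case 1
            then show ?thesis using h_monic d by (simp add: g_def c_def d_def coeff_pCons split: nat.split)
          next
            case 2
            then show ?thesis using *(1)
              by (auto simp: g_def B_def d_def coeff_pCons coeff_eq_0 split: nat.split)
          qed
        qed
      qed (use d in simp)
      fix i
      have hT: "- coeff h i \<in> T0" using T0(2) by (auto simp: Y0_def)
      have "\<exists>t\<in>T0. \<exists>v\<in>V. c * - coeff h i = t + of_nat p * v"
        using T0_mult[OF _ hT] fT unfolding c_def by blast
      then obtain t v where t: "t \<in> T0" "v \<in> V" "c * - coeff h i = t + of_nat p * v" by blast
      have "coeff (pCons 0 f) i \<in> T0" using fT T0_0 by (simp add: coeff_pCons split: nat.split)
      from T0_add[OF this t(1)] obtain s w where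
        s: "s \<in> T0" "w \<in> V" "coeff (pCons 0 f) i + t = s + of_nat p * w" by blast
      have "coeff g i = coeff (pCons 0 f) i + c * - coeff h i" by (simp add: g_def)
      also have "\<dots> = (coeff (pCons 0 f) i + t) + of_nat p * v"
        unfolding t(3) by (simp only: add.assoc)
      also have "\<dots> = s + of_nat p * (w + v)" unfolding s(3) by (simp only: distrib_left add.assoc)
      finally have "coeff g i = s + of_nat p * (w + v)" .
      moreover have "w + v \<in> V" using s(2) t(2) by (rule base.add_in)
      ultimately show "\<exists>t\<in>T0. \<exists>v\<in>V. coeff g i = t + of_nat p * v"
        using s(1) by blast
    qed
    moreover have "x * y = poly g x + of_nat p * (x * v)"
      using h_root *(3) by (simp add: g_def algebra_simps)
    ultimately show ?thesis using rep_trans[OF _ W.mult_in[OF x_W *(2)]] by blast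
  qed
  have rep_mult: "rep (poly f x * y)" if "f \<in> polys_over T0" "rep y" for f y
    using that(1)
  proof (induction f)
    case 0
    then show ?case using rep_T0 T0_0 by simp
  next
    case (pCons a f)
    have af: "a \<in> T0" "f \<in> polys_over T0"
      using polys_over_pConsD[OF pCons.prems] by blast+
    have "poly (pCons a f) x * y = a * y + x * (poly f x * y)" by (simp add: algebra_simps)
    then show ?case using rep_add[OF rep_scale[OF af(1) that(2)] rep_x[OF pCons.IH[OF af(2)]]] by simp
  qed
  have rep_poly: "rep (poly f x)" if "f \<in> polys_over T0" for f
    using rep_mult[OF that rep_T0[OF T0_0(2)]] by simp
  have rep_T: "\<exists>t\<in>T. \<exists>v\<in>adjoin V x. y = t + of_nat p * v" if "rep y" for y
    using that unfolding rep_def T_def by blast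
  have T_rep: "\<exists>f\<in>polys_over T0. y = poly f x" if "y \<in> T" for y
    using that unfolding T_def B_def by blast
  have "closed_mod (of_nat p) (adjoin V x) T"
    unfolding closed_mod_def
  proof (intro conjI ballI)
    show "T \<subseteq> adjoin V x"
      using T0_V polys_over_mono[OF T0_V] unfolding T_def B_def by (auto intro!: WI)
  next
    fix y z assume "y \<in> T" "z \<in> T"
    then obtain f g where fg: "f \<in> polys_over T0" "y = poly f x" "g \<in> polys_over T0" "z = poly g x"
      using T_rep by meson
    show "\<exists>t\<in>T. \<exists>v\<in>adjoin V x. y + z = t + of_nat p * v"
      using fg rep_T rep_add rep_poly by simp
    show "\<exists>t\<in>T. \<exists>v\<in>adjoin V x. y * z = t + of_nat p * v"
      using fg rep_T rep_mult rep_poly by simp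
  qed
  then have "closed_mod (of_nat p) (adjoin V x) (Y \<union> T)"
  proof (rule W.closed_mod_extend)
    fix y assume y: "y \<in> Y"
    have "range (coeff (F y)) \<subseteq> T0" using T0(2) y unfolding Y0_def by blast
    then have "F y \<in> polys_over T0" by (auto simp: polys_over_def)
    then show "\<exists>t\<in>T. \<exists>v\<in>adjoin V x. y = t + of_nat p * v"
      using rep_T[OF rep_poly] F(2)[OF y] by metis
  qed (use Y in auto)
  then show ?thesis using \<open>finite T\<close> Y(1) by (intro exI[of _ "Y \<union> T"]) auto
qed

text \<open>
  The powers of x below the degree of h form a basis of K[x] over K and of V[x] over V, so an element
  of K that lies in V[x] lies in V. This is why p stays a nonunit.
\<close>

lemma residual_ring_adjoin: "residual_ring p (adjoin K x) (adjoin V x)"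
proof -
  interpret W: subring_set "adjoin V x" by (rule base.subring_adjoin)
  interpret L: subring_set "adjoin K x" by (rule K.subring_adjoin)
  show ?thesis
  proof
    show "prime p" by (rule base.prime_p)
    show "inverse y \<in> adjoin K x" if "y \<in> adjoin K x" for y using that by (rule inverse_adjoin)
    show "adjoin V x \<subseteq> adjoin K x" using V_poly_K by (auto simp: adjoin_def)
    show "\<exists>s. of_nat p ^ s * y \<in> adjoin V x" if y: "y \<in> adjoin K x" for y
    proof -
      obtain f where f: "f \<in> polys_over K" "y = poly f x" using y by (auto simp: adjoin_def)
      obtain s where "smult (of_nat p ^ s) f \<in> polys_over V"
        using base.poly_common_denominator[OF f(1)] by blast
      moreover have "of_nat p ^ s * y = poly (smult (of_nat p ^ s) f) x" using f(2) by simp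
      ultimately show ?thesis unfolding adjoin_def by blast
    qed
    show "inverse (of_nat p) \<notin> adjoin V x"
    proof
      assume "inverse (of_nat p) \<in> adjoin V x"
      then obtain f where f: "f \<in> polys_over V" "inverse (of_nat p) = poly f x" by (auto simp: adjoin_def)
      obtain q r where q: "r \<in> polys_over V" "f = q * h + r" "degree r < degree h"
        using base.monic_division[OF h_integral h_monic degree_h_pos f(1)] by blast
      have "r = [:inverse (of_nat p):]"
      proof (rule poly_eq_imp_eq)
        show "r \<in> polys_over K" using q(1) V_poly_K by blast
        show "[:inverse (of_nat p):] \<in> polys_over K" by (simp add: inverse_in)
        show "poly r x = poly [:inverse (of_nat p):] x" using f(2) q(2) h_root by simp
      qed (use q(3) degree_h_pos in simp_all)
      then have "inverse (of_nat p) = coeff r 0" by simp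
      then show False using q(1) base.p_not_unit by (simp add: polys_over_def)
    qed
    show "\<exists>T. finite T \<and> Y \<subseteq> T \<and> closed_mod (of_nat p) (adjoin V x) T"
      if "finite Y" "Y \<subseteq> adjoin V x" for Y using that by (rule residues_adjoin)
  qed
qed

end

text \<open>
  The prime p may depend on the finite set B, since it has to avoid the denominators in B; in the
  extension steps, B is replaced by the coefficients that describe its members. Countability of K is carried along for the diagonal construction in the transcendental case.
\<close>

definition has_padic_rings :: "'a::field_char_0 set \<Rightarrow> bool" where
  "has_padic_rings K \<longleftrightarrow> countable K \<and> subring_set K \<and> (\<forall>x\<in>K. inverse x \<in> K) \<and>
     (\<forall>B. finite B \<and> B \<subseteq> K \<longrightarrow> (\<exists>p V. padic_ring p K V \<and> B \<subseteq> V))"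

lemma has_padic_rings_Rats: "has_padic_rings (\<rat> :: 'a::field_char_0 set)"
  unfolding has_padic_rings_def
proof (intro conjI allI impI ballI)
  show "countable (\<rat> :: 'a set)" by (rule countable_rat)
  show "subring_set (\<rat> :: 'a set)" by standard auto
  show "inverse x \<in> \<rat>" if "x \<in> \<rat>" for x :: 'a using that by (rule Rats_inverse)
  fix B :: "'a set" assume B: "finite B \<and> B \<subseteq> \<rat>"
  have "\<forall>x\<in>B. \<exists>a b. b > 0 \<and> x = of_int a / of_int b" using B by (blast elim: Rats_cases')
  then obtain a b where ab: "\<And>x. x \<in> B \<Longrightarrow> b x > 0" "\<And>x. x \<in> B \<Longrightarrow> x = of_int (a x) / of_int (b x)"
    by metis
  obtain p :: nat where p: "prime p" "p > nat (Max (insert 0 (b ` B)))" using bigger_prime by blast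
  have "\<not> int p dvd b x" if "x \<in> B" for x
  proof
    assume "int p dvd b x"
    then have "int p \<le> b x" using ab(1)[OF that] by (rule zdvd_imp_le)
    also have "b x \<le> Max (insert 0 (b ` B))" using B that by (intro Max_ge) auto
    also have "\<dots> < int p" using p(2) by linarith
    finally show False by simp
  qed
  then have "B \<subseteq> {of_int a / of_int b | a b. \<not> int p dvd b}" using ab(2) by blast
  then show "\<exists>p V. padic_ring p \<rat> V \<and> B \<subseteq> V" using padic_ring_Rats[OF p(1)] by blast
qed

lemma has_padic_rings_algebraic:
  assumes K: "has_padic_rings K" and x: "g \<in> polys_over K" "g \<noteq> 0" "poly g x = 0"
  shows "has_padic_rings (adjoin K x)"
proof -
  interpret K: subring_set K using K by (simp add: has_padic_rings_def)
  have inv: "\<And>c. c \<in> K \<Longrightarrow> inverse c \<in> K" using K by (simp add: has_padic_rings_def)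
  define P where "P f \<longleftrightarrow> f \<in> polys_over K \<and> f \<noteq> 0 \<and> poly f x = 0" for f
  obtain f where f: "P f" "\<And>f'. P f' \<Longrightarrow> degree f \<le> degree f'"
    using ex_has_least_nat[of P g degree] x unfolding P_def by blast
  define h where "h = smult (inverse (lead_coeff f)) f"
  interpret algebraic_extension K h x
  proof
    show "\<And>c. c \<in> K \<Longrightarrow> inverse c \<in> K" by (rule inv)
    have "lead_coeff f \<in> K" using f(1) by (simp add: P_def polys_over_def)
    then show "h \<in> polys_over K" using f(1) inv by (simp add: h_def P_def)
    show "lead_coeff h = 1" "poly h x = 0" using f(1) by (simp_all add: h_def P_def)
    have dh: "degree h = degree f" using f(1) by (simp add: h_def P_def)
    show "e = 0" if "e \<in> polys_over K" "poly e x = 0" "degree e < degree h" for e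
      using f(2)[of e] that unfolding P_def dh by linarith
  qed
  show ?thesis unfolding has_padic_rings_def
  proof (intro conjI allI impI ballI)
    have "adjoin K x = (\<lambda>f. poly f x) ` polys_over K" by (auto simp: adjoin_def)
    then show "countable (adjoin K x)"
      using countable_polys_over K by (auto simp: has_padic_rings_def)
    show "subring_set (adjoin K x)" by (rule K.subring_adjoin)
    show "inverse y \<in> adjoin K x" if "y \<in> adjoin K x" for y using that by (rule inverse_adjoin)
    fix B assume B: "finite B \<and> B \<subseteq> adjoin K x"
    have "\<forall>y\<in>B. \<exists>f\<in>polys_over K. y = poly f x" using B by (auto simp: adjoin_def)
    then obtain F where F: "\<And>y. y \<in> B \<Longrightarrow> F y \<in> polys_over K" "\<And>y. y \<in> B \<Longrightarrow> y = poly (F y) x"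
      by metis
    define B0 where "B0 = range (coeff h) \<union> (\<Union>y\<in>B. range (coeff (F y)))"
    have "finite B0" "B0 \<subseteq> K"
      using B F(1) h_over finite_coeffs by (auto simp: B0_def polys_over_def)
    then obtain p V where V: "padic_ring p K V" "B0 \<subseteq> V"
      using K unfolding has_padic_rings_def by blast
    interpret V: padic_ring p K V by (rule V(1))
    interpret algebraic_padic_extension p K V h x
      using V(2) by unfold_locales (auto simp: B0_def polys_over_def)
    obtain W where W: "adjoin V x \<subseteq> W" "padic_ring p (adjoin K x) W"
      using residual_ring.padic_ring_localisation[OF residual_ring_adjoin] by blast
    have "B \<subseteq> adjoin V x"
    proof
      fix y assume y: "y \<in> B"
      then have "range (coeff (F y)) \<subseteq> V" using V(2) unfolding B0_def by blast
      then have "F y \<in> polys_over V" by (auto simp: polys_over_def)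
      then show "y \<in> adjoin V x" using F(2)[OF y] unfolding adjoin_def by blast
    qed
    then show "\<exists>p V. padic_ring p (adjoin K x) V \<and> B \<subseteq> V" using W by blast
  qed
qed

section \<open>Transcendental extensions\<close>

lemma (in subring_set) poly_diff_factor:
  assumes "f \<in> polys_over V" "x \<in> V" "y \<in> V"
  shows "\<exists>w\<in>V. poly f x - poly f y = (x - y) * w"
  using assms(1)
proof (induction f)
  case 0
  then show ?case by (intro bexI[of _ 0]) simp_all
next
  case (pCons a f)
  have f: "f \<in> polys_over V" using polys_over_pConsD[OF pCons.prems] by blast
  obtain w where w: "w \<in> V" "poly f x - poly f y = (x - y) * w" using pCons.IH[OF f] by blast
  have "poly (pCons a f) x - poly (pCons a f) y = x * (poly f x - poly f y) + (x - y) * poly f y"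
    by (simp add: algebra_simps)
  also have "\<dots> = (x - y) * (x * w + poly f y)" unfolding w(2) by (simp add: algebra_simps)
  finally have "poly (pCons a f) x - poly (pCons a f) y = (x - y) * (x * w + poly f y)" .
  moreover have "x * w + poly f y \<in> V" using assms f w by simp
  ultimately show ?case by blast
qed

lemma ex_int_nonroot:
  fixes f :: "'a::field_char_0 poly" and a b :: int
  assumes "f \<noteq> 0" "b \<noteq> 0"
  shows "\<exists>k. poly f (of_int (a + k * b)) \<noteq> 0"
proof (rule ccontr)
  assume "\<not> ?thesis"
  then have "range (\<lambda>k. of_int (a + k * b)) \<subseteq> {x. poly f x = 0}" by auto
  then have "finite (range (\<lambda>k. of_int (a + k * b) :: 'a))"
    using poly_roots_finite[OF assms(1)] finite_subset by blast
  moreover have "inj (\<lambda>k. of_int (a + k * b) :: 'a)" using assms(2) by (auto intro!: injI)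
  ultimately show False using finite_imageD infinite_UNIV_int by blast
qed

context padic_ring
begin

text \<open>
  If d is close to c relative to the power of p in c, then c and d are divisible by the same powers of p.
\<close>

lemma one_plus_p_multiple_unit:
  assumes "c \<in> K" "c \<noteq> 0" "of_nat p ^ r * inverse c \<in> V" "z \<in> V" "d = c * (1 + of_nat p * z)"
  shows "d \<noteq> 0" "of_nat p ^ r * inverse d \<in> V"
proof -
  show "d \<noteq> 0" using assms(2,4,5) one_plus_p_nonzero by simp
  have "of_nat p ^ r * inverse d = (of_nat p ^ r * inverse c) * inverse (1 + of_nat p * z)"
    unfolding assms(5) by (simp add: mult_ac)
  also have "\<dots> \<in> V" using assms(3) one_plus_p_unit[OF assms(4)] by (rule mult_in)
  finally show "of_nat p ^ r * inverse d \<in> V" .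
qed

text \<open>
  A single step of the diagonal construction: near any integer a there is an integer a' where f does
  not vanish, and the divisibility of the values by p is then bounded uniformly over all integers
  close enough to a'.
\<close>

lemma stable_nonzero_value:
  assumes f: "f \<in> polys_over K" "f \<noteq> 0"
  shows "\<exists>a' e' s. e' > e \<and> int p ^ e dvd a' - a \<and>
    (\<forall>b. int p ^ e' dvd b - a' \<longrightarrow> poly f (of_int b) \<noteq> 0 \<and> of_nat p ^ s * inverse (poly f (of_int b)) \<in> V)"
proof -
  obtain k where k: "poly f (of_int (a + k * int p ^ e)) \<noteq> 0"
    using ex_int_nonroot[OF f(2), of "int p ^ e" a] by auto
  define a' where "a' = a + k * int p ^ e"
  define c where "c = poly f (of_int a')"
  have c: "c \<in> K" "c \<noteq> 0" unfolding c_def using f(1) k by (simp_all add: a'_def)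
  obtain s where s: "smult (of_nat p ^ s) f \<in> polys_over V"
    using poly_common_denominator[OF f(1)] by blast
  obtain r where r: "of_nat p ^ r * inverse c \<in> V" using p_denominator[OF inverse_K[OF c(1)]] by blast
  \<comment> \<open>s for the denominators of f, r for the value of f, and 1 more to land in 1 + pV\<close>
  define e' where "e' = e + s + r + 1"
  have "poly f (of_int b) \<noteq> 0 \<and> of_nat p ^ r * inverse (poly f (of_int b)) \<in> V"
    if b: "int p ^ e' dvd b - a'" for b
  proof -
    obtain j where j: "b - a' = int p ^ e' * j" using b by (auto elim: dvdE)
    obtain w where w: "w \<in> V" "poly (smult (of_nat p ^ s) f) (of_int b) - poly (smult (of_nat p ^ s) f) (of_int a')
        = (of_int b - of_int a') * w"
      using poly_diff_factor[OF s, of "of_int b" "of_int a'"] by auto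
    define z where "z = of_nat p ^ e * (of_nat p ^ r * inverse c) * of_int j * w"
    have z: "z \<in> V" unfolding z_def using r w(1) by simp
    have "(of_int b - of_int a' :: 'a) = of_int (int p ^ e' * j)" unfolding j[symmetric] by simp
    also have "\<dots> = of_nat p ^ s * (of_nat p ^ (e + r + 1) * of_int j)"
      by (simp add: e'_def power_add mult_ac)
    finally have "of_nat p ^ s * (poly f (of_int b) - c) = of_nat p ^ s * (of_nat p ^ (e + r + 1) * of_int j * w)"
      using w(2) by (simp add: c_def algebra_simps)
    then have "poly f (of_int b) - c = of_nat p ^ (e + r + 1) * of_int j * w" by simp
    also have "\<dots> = c * (of_nat p * z)" using c(2) by (simp add: z_def power_add mult_ac)
    finally have "poly f (of_int b) = c * (1 + of_nat p * z)" by (simp add: algebra_simps)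
    then show ?thesis using one_plus_p_multiple_unit[OF c r z] by blast
  qed
  moreover have "int p ^ e dvd a' - a" by (simp add: a'_def)
  moreover have "e' > e" by (simp add: e'_def)
  ultimately show ?thesis by blast
qed

text \<open>
  The sequence stands for a p-adic integer that is transcendental over K. Its n-th member secures that
  the n-th polynomial of an enumeration takes values of bounded p-divisibility from then on, and all
  later members are chosen so close to it that this is not disturbed.
\<close>

lemma ex_generic_integer_sequence:
  assumes "countable K"
  shows "\<exists>\<tau> :: nat \<Rightarrow> int. (\<forall>m. int p dvd \<tau> m - a) \<and> (\<forall>e. \<exists>N. \<forall>m\<ge>N. \<forall>n\<ge>N. int p ^ e dvd \<tau> m - \<tau> n) \<and>
    (\<forall>f\<in>polys_over K. f \<noteq> 0 \<longrightarrow> (\<exists>N s. \<forall>m\<ge>N. poly f (of_int (\<tau> m)) \<noteq> 0 \<and>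
        of_nat p ^ s * inverse (poly f (of_int (\<tau> m))) \<in> V))"
proof -
  define A where "A = polys_over K - {0}"
  have "1 \<in> A" by (simp add: A_def)
  then have A: "A \<noteq> {}" by blast
  have A_countable: "countable A"
    unfolding A_def by (intro countable_Diff countable_polys_over assms)
  define F where "F = from_nat_into A"
  have F: "F n \<in> polys_over K" "F n \<noteq> 0" for n
    using from_nat_into[OF A, of n] by (simp_all add: F_def A_def)
  define good where "good n a e \<longleftrightarrow> (\<exists>s. \<forall>b. int p ^ e dvd b - a \<longrightarrow>
      poly (F n) (of_int b) \<noteq> 0 \<and> of_nat p ^ s * inverse (poly (F n) (of_int b)) \<in> V)" for n a e
  define Q where "Q n x y \<longleftrightarrow> snd y > snd x \<and> int p ^ snd x dvd fst y - fst x \<and> good n (fst y) (snd y)"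
    for n and x y :: "int \<times> nat"
  have "\<exists>g. \<forall>n. (n = 0 \<longrightarrow> g n = (a, 1)) \<and> Q n (g n) (g (Suc n))"
  proof -
    have "\<exists>g. \<forall>n. (\<lambda>n x. n = 0 \<longrightarrow> x = (a, 1)) n (g n) \<and> Q n (g n) (g (Suc n))"
    proof (rule dependent_nat_choice)
      show "\<exists>x. 0 = 0 \<longrightarrow> x = (a, 1)" by blast
      fix x :: "int \<times> nat" and n :: nat
      obtain a' e' s where *: "e' > snd x" "int p ^ snd x dvd a' - fst x"
        "\<forall>b. int p ^ e' dvd b - a' \<longrightarrow> poly (F n) (of_int b) \<noteq> 0 \<and>
           of_nat p ^ s * inverse (poly (F n) (of_int b)) \<in> V"
        using stable_nonzero_value[OF F, of "snd x" "fst x" n] by (elim exE conjE) (rule that)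
      have "good n a' e'" unfolding good_def using *(3) by (rule exI)
      then have "Q n x (a', e')" unfolding Q_def using * by simp
      then show "\<exists>y. (Suc n = 0 \<longrightarrow> y = (a, 1)) \<and> Q n x y" by blast
    qed
    then show ?thesis by simp
  qed
  then obtain g where g: "g 0 = (a, 1)" "\<And>n. Q n (g n) (g (Suc n))" by blast
  define \<tau> where "\<tau> n = fst (g n)" for n
  define e where "e n = snd (g n)" for n
  have e0: "\<tau> 0 = a" "e 0 = 1" using g(1) by (simp_all add: \<tau>_def e_def)
  have step: "e (Suc n) > e n" "int p ^ e n dvd \<tau> (Suc n) - \<tau> n" "good n (\<tau> (Suc n)) (e (Suc n))" for n
    using g(2)[of n] by (simp_all add: Q_def \<tau>_def e_def)
  have e_mono: "e m \<le> e n" if "m \<le> n" for m n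
    using lift_Suc_mono_le[of e, OF less_imp_le[OF step(1)] that] .
  have e_ge: "e n \<ge> n" for n
  proof (induction n)
    case (Suc n)
    then show ?case using step(1)[of n] by simp
  qed simp
  note step_dvd = step(2)
  have cong: "int p ^ e n dvd \<tau> m - \<tau> n" if "m \<ge> n" for m n
    using that
  proof (induction m rule: dec_induct)
    case (step k)
    have "int p ^ e n dvd \<tau> (Suc k) - \<tau> k"
      using e_mono[OF step.hyps(1)] step_dvd[of k] by (meson dvd_trans le_imp_power_dvd)
    from dvd_add[OF this step.IH] show ?case by simp
  qed simp
  show ?thesis
  proof (intro exI[of _ \<tau>] conjI allI ballI impI)
    fix m
    show "int p dvd \<tau> m - a" using cong[of 0 m] e0 by simp
  next
    fix k
    show "\<exists>N. \<forall>m\<ge>N. \<forall>n\<ge>N. int p ^ k dvd \<tau> m - \<tau> n"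
    proof (intro exI[of _ k] allI impI)
      fix m n assume "m \<ge> k" "n \<ge> k"
      then have "int p ^ e k dvd \<tau> m - \<tau> k" "int p ^ e k dvd \<tau> n - \<tau> k" using cong by blast+
      from dvd_diff[OF this] have "int p ^ e k dvd \<tau> m - \<tau> n" by simp
      then show "int p ^ k dvd \<tau> m - \<tau> n" using e_ge[of k] by (meson dvd_trans le_imp_power_dvd)
    qed
  next
    fix f assume f: "f \<in> polys_over K" "f \<noteq> 0"
    then have "f \<in> range F" unfolding F_def range_from_nat_into[OF A A_countable] by (simp add: A_def)
    then obtain n where n: "f = F n" by blast
    obtain s where s: "\<And>b. int p ^ e (Suc n) dvd b - \<tau> (Suc n) \<Longrightarrow> poly f (of_int b) \<noteq> 0 \<and>
        of_nat p ^ s * inverse (poly f (of_int b)) \<in> V"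
      using step(3)[of n] unfolding good_def n by blast
    show "\<exists>N s. \<forall>m\<ge>N. poly f (of_int (\<tau> m)) \<noteq> 0 \<and> of_nat p ^ s * inverse (poly f (of_int (\<tau> m))) \<in> V"
      by (intro exI[of _ "Suc n"] exI[of _ s] allI impI) (rule s[OF cong])
  qed
qed

text \<open>
  Boundedness, in the sense that almost all values lie in p^(-k) V for a fixed k, is what makes
  products of Cauchy sequences Cauchy.
\<close>

definition adic_cauchy :: "(nat \<Rightarrow> 'a) \<Rightarrow> bool" where
  "adic_cauchy s \<longleftrightarrow> (\<exists>k N. \<forall>m\<ge>N. of_nat p ^ k * s m \<in> V) \<and>
     (\<forall>e. \<exists>N. \<forall>m\<ge>N. \<forall>n\<ge>N. \<exists>v\<in>V. s m - s n = of_nat p ^ e * v)"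

lemma adic_cauchyI:
  assumes "\<And>m. m \<ge> N \<Longrightarrow> of_nat p ^ k * s m \<in> V"
    and "\<And>e. \<exists>N. \<forall>m\<ge>N. \<forall>n\<ge>N. \<exists>v\<in>V. s m - s n = of_nat p ^ e * v"
  shows "adic_cauchy s"
  using assms unfolding adic_cauchy_def by blast

lemma adic_cauchyD:
  assumes "adic_cauchy s"
  obtains k N where "\<And>m. m \<ge> N \<Longrightarrow> of_nat p ^ k * s m \<in> V"
    "\<And>e. \<exists>N. \<forall>m\<ge>N. \<forall>n\<ge>N. \<exists>v\<in>V. s m - s n = of_nat p ^ e * v"
  using assms unfolding adic_cauchy_def by (elim conjE exE) blast

lemma adic_cauchy_const:
  assumes "c \<in> K"
  shows "adic_cauchy (\<lambda>m. c)"
proof -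
  obtain k where k: "of_nat p ^ k * c \<in> V" using p_denominator[OF assms] by blast
  have *: "\<forall>m\<ge>0::nat. \<forall>n\<ge>0::nat. \<exists>v\<in>V. c - c = of_nat p ^ e * v" for e
    by (intro allI impI bexI[of _ 0]) simp_all
  show ?thesis by (rule adic_cauchyI[OF k exI, OF *])
qed

lemma adic_cauchy_add:
  assumes "adic_cauchy s" "adic_cauchy t"
  shows "adic_cauchy (\<lambda>m. s m + t m)"
proof -
  obtain k N where s: "\<And>m. m \<ge> N \<Longrightarrow> of_nat p ^ k * s m \<in> V"
    "\<And>e. \<exists>N. \<forall>m\<ge>N. \<forall>n\<ge>N. \<exists>v\<in>V. s m - s n = of_nat p ^ e * v"
    using assms(1) by (rule adic_cauchyD) (rule that)
  obtain l M where t: "\<And>m. m \<ge> M \<Longrightarrow> of_nat p ^ l * t m \<in> V"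
    "\<And>e. \<exists>N. \<forall>m\<ge>N. \<forall>n\<ge>N. \<exists>v\<in>V. t m - t n = of_nat p ^ e * v"
    using assms(2) by (rule adic_cauchyD) (rule that)
  show ?thesis
  proof (rule adic_cauchyI[of "N + M" "k + l"])
    fix m assume m: "m \<ge> N + M"
    have "of_nat p ^ (k + l) * (s m + t m) = of_nat p ^ l * (of_nat p ^ k * s m) + of_nat p ^ k * (of_nat p ^ l * t m)"
      by (simp add: power_add algebra_simps)
    then show "of_nat p ^ (k + l) * (s m + t m) \<in> V" using s(1)[of m] t(1)[of m] m by simp
  next
    fix e
    obtain N1 where N1: "\<And>m n. m \<ge> N1 \<Longrightarrow> n \<ge> N1 \<Longrightarrow> \<exists>v\<in>V. s m - s n = of_nat p ^ e * v"
      using s(2)[of e] by blast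
    obtain N2 where N2: "\<And>m n. m \<ge> N2 \<Longrightarrow> n \<ge> N2 \<Longrightarrow> \<exists>v\<in>V. t m - t n = of_nat p ^ e * v"
      using t(2)[of e] by blast
    show "\<exists>N. \<forall>m\<ge>N. \<forall>n\<ge>N. \<exists>v\<in>V. s m + t m - (s n + t n) = of_nat p ^ e * v"
    proof (intro exI[of _ "N1 + N2"] allI impI)
      fix m n assume mn: "m \<ge> N1 + N2" "n \<ge> N1 + N2"
      obtain v where v: "v \<in> V" "s m - s n = of_nat p ^ e * v" using N1[of m n] mn by auto
      obtain w where w: "w \<in> V" "t m - t n = of_nat p ^ e * w" using N2[of m n] mn by auto
      have "s m + t m - (s n + t n) = of_nat p ^ e * (v + w)"
        unfolding distrib_left v(2)[symmetric] w(2)[symmetric] by simp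
      then show "\<exists>v\<in>V. s m + t m - (s n + t n) = of_nat p ^ e * v" using add_in[OF v(1) w(1)] by blast
    qed
  qed
qed

lemma adic_cauchy_mult:
  assumes "adic_cauchy s" "adic_cauchy t"
  shows "adic_cauchy (\<lambda>m. s m * t m)"
proof -
  obtain k N where s: "\<And>m. m \<ge> N \<Longrightarrow> of_nat p ^ k * s m \<in> V"
    "\<And>e. \<exists>N. \<forall>m\<ge>N. \<forall>n\<ge>N. \<exists>v\<in>V. s m - s n = of_nat p ^ e * v"
    using assms(1) by (rule adic_cauchyD) (rule that)
  obtain l M where t: "\<And>m. m \<ge> M \<Longrightarrow> of_nat p ^ l * t m \<in> V"
    "\<And>e. \<exists>N. \<forall>m\<ge>N. \<forall>n\<ge>N. \<exists>v\<in>V. t m - t n = of_nat p ^ e * v"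
    using assms(2) by (rule adic_cauchyD) (rule that)
  show ?thesis
  proof (rule adic_cauchyI[of "N + M" "k + l"])
    fix m assume "m \<ge> N + M"
    then have "of_nat p ^ k * s m \<in> V" "of_nat p ^ l * t m \<in> V" using s(1)[of m] t(1)[of m] by auto
    then have "(of_nat p ^ k * s m) * (of_nat p ^ l * t m) \<in> V" by (rule mult_in)
    then show "of_nat p ^ (k + l) * (s m * t m) \<in> V" by (simp only: power_add mult_ac)
  next
    fix e
    \<comment> \<open>the extra powers of p pay for the denominators of the other factor\<close>
    obtain N1 where N1: "\<And>m n. m \<ge> N1 \<Longrightarrow> n \<ge> N1 \<Longrightarrow> \<exists>v\<in>V. s m - s n = of_nat p ^ (e + l) * v"
      using s(2)[of "e + l"] by blast
    obtain N2 where N2: "\<And>m n. m \<ge> N2 \<Longrightarrow> n \<ge> N2 \<Longrightarrow> \<exists>v\<in>V. t m - t n = of_nat p ^ (e + k) * v"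
      using t(2)[of "e + k"] by blast
    show "\<exists>N. \<forall>m\<ge>N. \<forall>n\<ge>N. \<exists>v\<in>V. s m * t m - s n * t n = of_nat p ^ e * v"
    proof (intro exI[of _ "N1 + N2 + N + M"] allI impI)
      fix m n assume mn: "m \<ge> N1 + N2 + N + M" "n \<ge> N1 + N2 + N + M"
      obtain v where v: "v \<in> V" "s m - s n = of_nat p ^ (e + l) * v" using N1[of m n] mn by auto
      obtain w where w: "w \<in> V" "t m - t n = of_nat p ^ (e + k) * w" using N2[of m n] mn by auto
      have "s m * t m - s n * t n = (s m - s n) * t m + s n * (t m - t n)"
        by (simp add: algebra_simps)
      also have "\<dots> = of_nat p ^ e * (v * (of_nat p ^ l * t m) + (of_nat p ^ k * s n) * w)"
        unfolding v w by (simp add: power_add algebra_simps)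
      finally have "s m * t m - s n * t n = of_nat p ^ e * (v * (of_nat p ^ l * t m) + (of_nat p ^ k * s n) * w)" .
      moreover have "v * (of_nat p ^ l * t m) + (of_nat p ^ k * s n) * w \<in> V"
        using v(1) w(1) s(1)[of n] t(1)[of m] mn by simp
      ultimately show "\<exists>v\<in>V. s m * t m - s n * t n = of_nat p ^ e * v" by blast
    qed
  qed
qed

lemma adic_cauchy_inverse:
  assumes "adic_cauchy s" and inv: "\<And>m. m \<ge> M \<Longrightarrow> s m \<noteq> 0 \<and> of_nat p ^ l * inverse (s m) \<in> V"
  shows "adic_cauchy (\<lambda>m. inverse (s m))"
proof -
  obtain k N where s: "\<And>m. m \<ge> N \<Longrightarrow> of_nat p ^ k * s m \<in> V"
    "\<And>e. \<exists>N. \<forall>m\<ge>N. \<forall>n\<ge>N. \<exists>v\<in>V. s m - s n = of_nat p ^ e * v"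
    using assms(1) by (rule adic_cauchyD) (rule that)
  show ?thesis
  proof (rule adic_cauchyI[of M l])
    show "of_nat p ^ l * inverse (s m) \<in> V" if "m \<ge> M" for m using inv[OF that] by blast
  next
    fix e
    \<comment> \<open>1/x - 1/y = (y - x) / (x y), where 1/x and 1/y cost p^l each\<close>
    obtain N1 where N1: "\<And>m n. m \<ge> N1 \<Longrightarrow> n \<ge> N1 \<Longrightarrow> \<exists>v\<in>V. s m - s n = of_nat p ^ (e + l + l) * v"
      using s(2)[of "e + l + l"] by blast
    show "\<exists>N. \<forall>m\<ge>N. \<forall>n\<ge>N. \<exists>v\<in>V. inverse (s m) - inverse (s n) = of_nat p ^ e * v"
    proof (intro exI[of _ "N1 + M"] allI impI)
      fix m n assume mn: "m \<ge> N1 + M" "n \<ge> N1 + M"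
      obtain v where v: "v \<in> V" "s n - s m = of_nat p ^ (e + l + l) * v" using N1[of n m] mn by auto
      have nz: "s m \<noteq> 0" "s n \<noteq> 0" using inv[of m] inv[of n] mn by auto
      have "inverse (s m) - inverse (s n) = (s n - s m) * inverse (s m) * inverse (s n)"
        using nz by (simp add: field_simps)
      also have "\<dots> = of_nat p ^ e * (v * (of_nat p ^ l * inverse (s m)) * (of_nat p ^ l * inverse (s n)))"
        unfolding v by (simp add: power_add mult_ac)
      finally have "inverse (s m) - inverse (s n) =
          of_nat p ^ e * (v * (of_nat p ^ l * inverse (s m)) * (of_nat p ^ l * inverse (s n)))" .
      moreover have "v * (of_nat p ^ l * inverse (s m)) * (of_nat p ^ l * inverse (s n)) \<in> V"
        using v(1) inv[of m] inv[of n] mn by simp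
      ultimately show "\<exists>v\<in>V. inverse (s m) - inverse (s n) = of_nat p ^ e * v" by blast
    qed
  qed
qed

lemma adic_cauchy_poly:
  assumes "adic_cauchy s" "f \<in> polys_over K"
  shows "adic_cauchy (\<lambda>m. poly f (s m))"
  using assms(2)
proof (induction f)
  case 0
  then show ?case using adic_cauchy_const[of 0] by simp
next
  case (pCons a f)
  then show ?case using polys_over_pConsD[OF pCons.prems] assms(1)
    by (simp add: adic_cauchy_add adic_cauchy_mult adic_cauchy_const)
qed

end

definition adjoin_fractions :: "'a::field_char_0 set \<Rightarrow> 'a \<Rightarrow> 'a set" where
  "adjoin_fractions K t = {poly f t / poly g t | f g. f \<in> polys_over K \<and> g \<in> polys_over K \<and> g \<noteq> 0}"

lemma adjoin_fractionsI:
  "f \<in> polys_over K \<Longrightarrow> g \<in> polys_over K \<Longrightarrow> g \<noteq> 0 \<Longrightarrow> poly f t / poly g t \<in> adjoin_fractions K t"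
  by (auto simp: adjoin_fractions_def)

lemma adjoin_fractionsE:
  assumes "y \<in> adjoin_fractions K t"
  obtains f g where "f \<in> polys_over K" "g \<in> polys_over K" "g \<noteq> 0" "y = poly f t / poly g t"
  using assms by (auto simp: adjoin_fractions_def)

lemma (in subring_set) insert_subset_adjoin: "insert x V \<subseteq> adjoin V x"
proof
  fix y assume "y \<in> insert x V"
  then consider "y = poly [:0, 1:] x" | "y \<in> V" "y = poly [:y:] x" by auto
  then show "y \<in> adjoin V x"
  proof cases
    case 1
    have "[:0, 1:] \<in> polys_over V" by simp
    with 1 show ?thesis unfolding adjoin_def by blast
  next
    case 2
    have "[:y:] \<in> polys_over V" using 2(1) by simp
    with 2(2) show ?thesis unfolding adjoin_def by blast
  qed
qed

lemma (in subring_set) adjoin_subset_fractions: "adjoin V x \<subseteq> adjoin_fractions V x"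
proof
  fix y assume "y \<in> adjoin V x"
  then obtain f where "f \<in> polys_over V" "y = poly f x" by (auto simp: adjoin_def)
  then show "y \<in> adjoin_fractions V x" using adjoin_fractionsI[of f V 1 x] by simp
qed

locale transcendental_extension = K: subring_set K
  for K :: "'a::field_char_0 set" +
  fixes t :: 'a
  assumes transcendental: "f \<in> polys_over K \<Longrightarrow> poly f t = 0 \<Longrightarrow> f = 0"
begin

lemma poly_t_nonzero: "g \<in> polys_over K \<Longrightarrow> g \<noteq> 0 \<Longrightarrow> poly g t \<noteq> 0"
  using transcendental by blast

lemma inverse_adjoin_fractions:
  assumes "y \<in> adjoin_fractions K t"
  shows "inverse y \<in> adjoin_fractions K t"
proof -
  obtain f g where fg: "f \<in> polys_over K" "g \<in> polys_over K" "g \<noteq> 0" "y = poly f t / poly g t"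
    using assms by (rule adjoin_fractionsE)
  show ?thesis
  proof (cases "f = 0")
    case True
    then show ?thesis using adjoin_fractionsI[of 0 K 1 t] fg by simp
  next
    case False
    then show ?thesis using adjoin_fractionsI[of g K f t] fg by simp
  qed
qed

lemma subring_adjoin_fractions: "subring_set (adjoin_fractions K t)"
proof
  show "1 \<in> adjoin_fractions K t" using adjoin_fractionsI[of 1 K 1 t] by simp
  fix y z assume y: "y \<in> adjoin_fractions K t" and z: "z \<in> adjoin_fractions K t"
  obtain f g where fg: "f \<in> polys_over K" "g \<in> polys_over K" "g \<noteq> 0" "y = poly f t / poly g t"
    using y by (rule adjoin_fractionsE)
  obtain f' g' where fg': "f' \<in> polys_over K" "g' \<in> polys_over K" "g' \<noteq> 0" "z = poly f' t / poly g' t"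
    using z by (rule adjoin_fractionsE)
  have nz: "poly g t \<noteq> 0" "poly g' t \<noteq> 0" using poly_t_nonzero fg fg' by auto
  have "y - z = poly (f * g' - f' * g) t / poly (g * g') t"
    unfolding fg(4) fg'(4) using nz by (simp add: diff_frac_eq)
  then show "y - z \<in> adjoin_fractions K t"
    using fg fg' adjoin_fractionsI[of "f * g' - f' * g" K "g * g'" t] by simp
  have "y * z = poly (f * f') t / poly (g * g') t" using fg(4) fg'(4) by simp
  then show "y * z \<in> adjoin_fractions K t"
    using fg fg' adjoin_fractionsI[of "f * f'" K "g * g'" t] by simp
qed

end

locale transcendental_padic_extension =
  padic_ring p K V + transcendental_extension K t for p :: nat and K V :: "'a::field_char_0 set" and t +
  fixes \<tau> :: "nat \<Rightarrow> int"
  assumes \<tau>_cauchy: "\<exists>N. \<forall>m\<ge>N. \<forall>n\<ge>N. int p ^ e dvd \<tau> m - \<tau> n"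
    and \<tau>_generic: "f \<in> polys_over K \<Longrightarrow> f \<noteq> 0 \<Longrightarrow> \<exists>N s. \<forall>m\<ge>N. poly f (of_int (\<tau> m)) \<noteq> 0 \<and>
        of_nat p ^ s * inverse (poly f (of_int (\<tau> m))) \<in> V"
begin

text \<open>
  Substituting the integer approximations for t sends a rational function f/g in t to a sequence in K,
  which is determined by f(t)/g(t) up to finitely many entries because t is transcendental.
\<close>

definition specialises :: "'a \<Rightarrow> (nat \<Rightarrow> 'a) \<Rightarrow> bool" where
  "specialises y s \<longleftrightarrow> (\<exists>f\<in>polys_over K. \<exists>g\<in>polys_over K. g \<noteq> 0 \<and> y = poly f t / poly g t \<and>
     (\<forall>\<^sub>F m in sequentially. s m = poly f (of_int (\<tau> m)) / poly g (of_int (\<tau> m))))"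

lemma specialisesI:
  assumes "f \<in> polys_over K" "g \<in> polys_over K" "g \<noteq> 0" "y = poly f t / poly g t"
    "\<forall>\<^sub>F m in sequentially. s m = poly f (of_int (\<tau> m)) / poly g (of_int (\<tau> m))"
  shows "specialises y s"
  using assms unfolding specialises_def by blast

lemma specialisesE:
  assumes "specialises y s"
  obtains f g where "f \<in> polys_over K" "g \<in> polys_over K" "g \<noteq> 0" "y = poly f t / poly g t"
    "\<forall>\<^sub>F m in sequentially. s m = poly f (of_int (\<tau> m)) / poly g (of_int (\<tau> m))"
  using assms unfolding specialises_def by blast

lemma eventually_poly_nonzero:
  assumes "f \<in> polys_over K" "f \<noteq> 0"
  shows "\<forall>\<^sub>F m in sequentially. poly f (of_int (\<tau> m)) \<noteq> 0"
  using \<tau>_generic[OF assms] unfolding eventually_sequentially by blast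

lemma specialises_const: "c \<in> K \<Longrightarrow> specialises c (\<lambda>m. c)"
  by (rule specialisesI[of "[:c:]" 1]) auto

lemma specialises_diff:
  assumes "specialises y s" "specialises z r"
  shows "specialises (y - z) (\<lambda>m. s m - r m)"
proof -
  obtain f g where fg: "f \<in> polys_over K" "g \<in> polys_over K" "g \<noteq> 0" "y = poly f t / poly g t"
    "\<forall>\<^sub>F m in sequentially. s m = poly f (of_int (\<tau> m)) / poly g (of_int (\<tau> m))"
    using assms(1) by (rule specialisesE)
  obtain f' g' where fg': "f' \<in> polys_over K" "g' \<in> polys_over K" "g' \<noteq> 0" "z = poly f' t / poly g' t"
    "\<forall>\<^sub>F m in sequentially. r m = poly f' (of_int (\<tau> m)) / poly g' (of_int (\<tau> m))"
    using assms(2) by (rule specialisesE)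
  show ?thesis
  proof (rule specialisesI[of "f * g' - f' * g" "g * g'"])
    show "y - z = poly (f * g' - f' * g) t / poly (g * g') t"
      unfolding fg(4) fg'(4) using poly_t_nonzero[OF fg(2,3)] poly_t_nonzero[OF fg'(2,3)]
      by (simp add: diff_frac_eq)
    show "\<forall>\<^sub>F m in sequentially. s m - r m =
        poly (f * g' - f' * g) (of_int (\<tau> m)) / poly (g * g') (of_int (\<tau> m))"
      using fg(5) fg'(5) eventually_poly_nonzero[OF fg(2,3)] eventually_poly_nonzero[OF fg'(2,3)]
      by eventually_elim (simp add: diff_frac_eq)
  qed (use fg fg' in simp_all)
qed

lemma specialises_mult:
  assumes "specialises y s" "specialises z r"
  shows "specialises (y * z) (\<lambda>m. s m * r m)"
proof -
  obtain f g where fg: "f \<in> polys_over K" "g \<in> polys_over K" "g \<noteq> 0" "y = poly f t / poly g t"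
    "\<forall>\<^sub>F m in sequentially. s m = poly f (of_int (\<tau> m)) / poly g (of_int (\<tau> m))"
    using assms(1) by (rule specialisesE)
  obtain f' g' where fg': "f' \<in> polys_over K" "g' \<in> polys_over K" "g' \<noteq> 0" "z = poly f' t / poly g' t"
    "\<forall>\<^sub>F m in sequentially. r m = poly f' (of_int (\<tau> m)) / poly g' (of_int (\<tau> m))"
    using assms(2) by (rule specialisesE)
  show ?thesis
  proof (rule specialisesI[of "f * f'" "g * g'"])
    show "\<forall>\<^sub>F m in sequentially. s m * r m = poly (f * f') (of_int (\<tau> m)) / poly (g * g') (of_int (\<tau> m))"
      using fg(5) fg'(5) by eventually_elim simp
  qed (use fg fg' in simp_all)
qed

lemma specialises_inverse:
  assumes "specialises y s"
  shows "specialises (inverse y) (\<lambda>m. inverse (s m))"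
proof -
  obtain f g where fg: "f \<in> polys_over K" "g \<in> polys_over K" "g \<noteq> 0" "y = poly f t / poly g t"
    "\<forall>\<^sub>F m in sequentially. s m = poly f (of_int (\<tau> m)) / poly g (of_int (\<tau> m))"
    using assms(1) by (rule specialisesE)
  show ?thesis
  proof (cases "f = 0")
    case True
    have "\<forall>\<^sub>F m in sequentially. inverse (s m) = poly 0 (of_int (\<tau> m)) / poly 1 (of_int (\<tau> m))"
      using fg(5) by eventually_elim (simp add: True)
    then show ?thesis using True fg(4) by (intro specialisesI[of 0 1]) simp_all
  next
    case False
    have "\<forall>\<^sub>F m in sequentially. inverse (s m) = poly g (of_int (\<tau> m)) / poly f (of_int (\<tau> m))"
      using fg(5) by eventually_elim simp
    then show ?thesis using False fg by (intro specialisesI[of g f]) simp_all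
  qed
qed

lemma specialises_zero:
  assumes "specialises 0 s"
  shows "\<forall>\<^sub>F m in sequentially. s m = 0"
proof -
  obtain f g where fg: "f \<in> polys_over K" "g \<in> polys_over K" "g \<noteq> 0" "0 = poly f t / poly g t"
    "\<forall>\<^sub>F m in sequentially. s m = poly f (of_int (\<tau> m)) / poly g (of_int (\<tau> m))"
    using assms(1) by (rule specialisesE)
  have "f = 0" using fg(4) poly_t_nonzero[OF fg(2,3)] transcendental[OF fg(1)] by simp
  show ?thesis using fg(5) by eventually_elim (simp add: \<open>f = 0\<close>)
qed

lemma adic_cauchy_\<tau>: "adic_cauchy (\<lambda>m. of_int (\<tau> m))"
proof (rule adic_cauchyI[of 0 0])
  fix e
  obtain N where N: "\<And>m n. m \<ge> N \<Longrightarrow> n \<ge> N \<Longrightarrow> int p ^ e dvd \<tau> m - \<tau> n" using \<tau>_cauchy[of e] by blast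
  show "\<exists>N. \<forall>m\<ge>N. \<forall>n\<ge>N. \<exists>v\<in>V. of_int (\<tau> m) - of_int (\<tau> n) = of_nat p ^ e * v"
  proof (intro exI[of _ N] allI impI)
    fix m n assume "m \<ge> N" "n \<ge> N"
    then obtain j where j: "\<tau> m - \<tau> n = int p ^ e * j" using N by (meson dvdE)
    have "(of_int (\<tau> m) - of_int (\<tau> n) :: 'a) = of_int (int p ^ e * j)" unfolding j[symmetric] by simp
    also have "\<dots> = of_nat p ^ e * of_int j" by simp
    finally show "\<exists>v\<in>V. of_int (\<tau> m) - of_int (\<tau> n) = of_nat p ^ e * v" using of_int_in by blast
  qed
qed simp

text \<open>
  The genericity of the approximations keeps the denominators away from 0.
\<close>

lemma specialises_adic_cauchy:
  assumes "y \<in> adjoin_fractions K t"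
  shows "\<exists>s. specialises y s \<and> adic_cauchy s"
proof -
  obtain f g where fg: "f \<in> polys_over K" "g \<in> polys_over K" "g \<noteq> 0" "y = poly f t / poly g t"
    using assms by (rule adjoin_fractionsE)
  obtain N l where N: "\<And>m. m \<ge> N \<Longrightarrow> poly g (of_int (\<tau> m)) \<noteq> 0 \<and>
        of_nat p ^ l * inverse (poly g (of_int (\<tau> m))) \<in> V"
    using \<tau>_generic[OF fg(2,3)] by blast
  have "adic_cauchy (\<lambda>m. poly f (of_int (\<tau> m)) * inverse (poly g (of_int (\<tau> m))))"
    by (intro adic_cauchy_mult adic_cauchy_inverse[OF _ N] adic_cauchy_poly adic_cauchy_\<tau> fg)
  moreover have "specialises y (\<lambda>m. poly f (of_int (\<tau> m)) * inverse (poly g (of_int (\<tau> m))))"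
    using fg by (intro specialisesI[of f g]) (simp_all add: divide_inverse)
  ultimately show ?thesis by blast
qed

lemma specialises_in_fractions: "specialises y s \<Longrightarrow> y \<in> adjoin_fractions K t"
  by (elim specialisesE) (simp add: adjoin_fractionsI)

lemma specialises_unique:
  assumes "specialises y s" "specialises y r"
  shows "\<forall>\<^sub>F m in sequentially. s m = r m"
proof -
  have "specialises 0 (\<lambda>m. s m - r m)" using specialises_diff[OF assms] by simp
  from specialises_zero[OF this] show ?thesis by simp
qed

definition extension_ring :: "'a set" where
  "extension_ring = {y. \<exists>s. specialises y s \<and> (\<forall>\<^sub>F m in sequentially. s m \<in> V)}"

lemma extension_ringI:
  "specialises y s \<Longrightarrow> \<forall>\<^sub>F m in sequentially. s m \<in> V \<Longrightarrow> y \<in> extension_ring"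
  by (auto simp: extension_ring_def)

lemma extension_ringE:
  assumes "y \<in> extension_ring"
  obtains s where "specialises y s" "\<forall>\<^sub>F m in sequentially. s m \<in> V"
  using assms by (auto simp: extension_ring_def)

lemma V_subset_extension_ring: "V \<subseteq> extension_ring"
proof
  fix c assume "c \<in> V"
  then show "c \<in> extension_ring" using specialises_const[of c] V_subset by (intro extension_ringI) auto
qed

lemma subring_extension_ring: "subring_set extension_ring"
proof
  show "1 \<in> extension_ring" using V_subset_extension_ring one_in by (rule subsetD)
  fix y z assume y: "y \<in> extension_ring" and z: "z \<in> extension_ring"
  obtain s where s: "specialises y s" "\<forall>\<^sub>F m in sequentially. s m \<in> V" using y by (rule extension_ringE)
  obtain r where r: "specialises z r" "\<forall>\<^sub>F m in sequentially. r m \<in> V" using z by (rule extension_ringE)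
  show "y - z \<in> extension_ring"
    by (rule extension_ringI[OF specialises_diff[OF s(1) r(1)]]) (use s(2) r(2) in eventually_elim, simp)
  show "y * z \<in> extension_ring"
    by (rule extension_ringI[OF specialises_mult[OF s(1) r(1)]]) (use s(2) r(2) in eventually_elim, simp)
qed

text \<open>
  A Cauchy sequence in V is eventually constant modulo p, so every element of the new ring is congruent
  modulo p to an element of V, namely to one of the values of its specialisation.
\<close>

lemma residues_extension_ring:
  assumes Y: "finite Y" "Y \<subseteq> extension_ring"
  shows "\<exists>T. finite T \<and> Y \<subseteq> T \<and> closed_mod (of_nat p) extension_ring T"
proof -
  interpret W: subring_set extension_ring by (rule subring_extension_ring)
  have "\<exists>s. specialises y s \<and> (\<forall>\<^sub>F n in sequentially. s n \<in> V \<and>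
      (\<forall>m\<ge>n. \<exists>v\<in>V. s m - s n = of_nat p * v))" if y: "y \<in> Y" for y
  proof -
    have "y \<in> extension_ring" using y Y by blast
    then obtain r where r: "specialises y r" "\<forall>\<^sub>F m in sequentially. r m \<in> V" by (rule extension_ringE)
    obtain s where s: "specialises y s" "adic_cauchy s"
      using specialises_adic_cauchy[OF specialises_in_fractions[OF r(1)]] by blast
    have 1: "\<forall>\<^sub>F m in sequentially. s m \<in> V"
      using specialises_unique[OF s(1) r(1)] r(2) by eventually_elim simp
    obtain N where N: "\<And>m n. m \<ge> N \<Longrightarrow> n \<ge> N \<Longrightarrow> \<exists>v\<in>V. s m - s n = of_nat p ^ 1 * v"
      using s(2) unfolding adic_cauchy_def by blast
    have 2: "\<forall>\<^sub>F n in sequentially. \<forall>m\<ge>n. \<exists>v\<in>V. s m - s n = of_nat p * v"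
      using eventually_ge_at_top[of N] by eventually_elim (use N in simp)
    show ?thesis using s(1) eventually_conj[OF 1 2] by blast
  qed
  then have "\<forall>y\<in>Y. \<exists>s. specialises y s \<and> (\<forall>\<^sub>F n in sequentially. s n \<in> V \<and>
      (\<forall>m\<ge>n. \<exists>v\<in>V. s m - s n = of_nat p * v))" by (rule ballI)
  from bchoice[OF this] obtain s where s: "\<forall>y\<in>Y. specialises y (s y) \<and>
      (\<forall>\<^sub>F n in sequentially. s y n \<in> V \<and> (\<forall>m\<ge>n. \<exists>v\<in>V. s y m - s y n = of_nat p * v))" ..
  have "\<forall>\<^sub>F n in sequentially. \<forall>y\<in>Y. s y n \<in> V \<and> (\<forall>m\<ge>n. \<exists>v\<in>V. s y m - s y n = of_nat p * v)"
    by (rule eventually_ball_finite[OF Y(1)]) (use s in blast)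
  then obtain n where n: "\<And>y. y \<in> Y \<Longrightarrow> s y n \<in> V"
    "\<And>y m. y \<in> Y \<Longrightarrow> m \<ge> n \<Longrightarrow> \<exists>v\<in>V. s y m - s y n = of_nat p * v"
    unfolding eventually_sequentially by blast
  have "finite ((\<lambda>y. s y n) ` Y)" "(\<lambda>y. s y n) ` Y \<subseteq> V" using Y n(1) by auto
  from residues_finite[OF this] obtain T
    where T: "finite T" "(\<lambda>y. s y n) ` Y \<subseteq> T" "closed_mod (of_nat p) V T" by blast
  have "closed_mod (of_nat p) extension_ring (Y \<union> T)"
  proof (rule W.closed_mod_extend[OF T(3) V_subset_extension_ring])
    fix y assume y: "y \<in> Y"
    have sy: "specialises y (s y)" using s y by blast
    have K: "s y n \<in> K" "inverse (of_nat p) \<in> K" using n(1)[OF y] V_subset inverse_K by auto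
    have "(y - s y n) * inverse (of_nat p) \<in> extension_ring"
    proof (rule extension_ringI)
      show "specialises ((y - s y n) * inverse (of_nat p)) (\<lambda>m. (s y m - s y n) * inverse (of_nat p))"
        by (intro specialises_mult specialises_diff specialises_const sy K)
      have "(s y m - s y n) * inverse (of_nat p) \<in> V" if m: "m \<ge> n" for m
      proof -
        obtain v where v: "v \<in> V" "s y m - s y n = of_nat p * v" using n(2)[OF y m] by blast
        have "(s y m - s y n) * inverse (of_nat p) = v" unfolding v(2) by (simp add: field_simps)
        then show ?thesis using v(1) by (simp only:)
      qed
      then show "\<forall>\<^sub>F m in sequentially. (s y m - s y n) * inverse (of_nat p) \<in> V"
        unfolding eventually_sequentially by blast
    qed
    moreover have "y = s y n + of_nat p * ((y - s y n) * inverse (of_nat p))" by (simp add: field_simps)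
    moreover have "s y n \<in> T" using T(2) y by blast
    ultimately show "\<exists>c\<in>T. \<exists>v\<in>extension_ring. y = c + of_nat p * v" by blast
  qed (use Y in auto)
  then show ?thesis using T(1) Y(1) by (intro exI[of _ "Y \<union> T"]) auto
qed

lemma padic_ring_extension: "padic_ring p (adjoin_fractions K t) extension_ring"
proof -
  interpret L: subring_set "adjoin_fractions K t" by (rule subring_adjoin_fractions)
  interpret W: subring_set extension_ring by (rule subring_extension_ring)
  have pW: "of_nat p \<in> extension_ring" by simp
  have K_p: "inverse (of_nat p) \<in> K" by (rule inverse_K) simp
  show ?thesis
  proof
    show "prime p" by (rule prime_p)
    show "inverse y \<in> adjoin_fractions K t" if "y \<in> adjoin_fractions K t" for y
      using that by (rule inverse_adjoin_fractions)
    show "extension_ring \<subseteq> adjoin_fractions K t"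
      using specialises_in_fractions by (auto simp: extension_ring_def)
    show "\<exists>k. of_nat p ^ k * y \<in> extension_ring" if y: "y \<in> adjoin_fractions K t" for y
    proof -
      obtain s where s: "specialises y s" "adic_cauchy s" using specialises_adic_cauchy[OF y] by blast
      obtain k N where k: "\<forall>m\<ge>N. of_nat p ^ k * s m \<in> V" using s(2) unfolding adic_cauchy_def by blast
      have "specialises (of_nat p ^ k * y) (\<lambda>m. of_nat p ^ k * s m)"
        by (intro specialises_mult specialises_const s(1)) simp
      then have "of_nat p ^ k * y \<in> extension_ring"
        by (rule extension_ringI) (use k in \<open>auto simp: eventually_sequentially\<close>)
      then show ?thesis by blast
    qed
    show "inverse (of_nat p) \<notin> extension_ring"
    proof
      assume "inverse (of_nat p) \<in> extension_ring"
      then obtain s where s: "specialises (inverse (of_nat p)) s" "\<forall>\<^sub>F m in sequentially. s m \<in> V"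
        by (rule extension_ringE)
      have "\<forall>\<^sub>F m in sequentially. inverse (of_nat p) \<in> V"
        using specialises_unique[OF s(1) specialises_const[OF K_p]] s(2) by eventually_elim simp
      then show False using p_not_unit by simp
    qed
    show "inverse (1 + of_nat p * y) \<in> extension_ring" if y: "y \<in> extension_ring" for y
    proof -
      obtain s where s: "specialises y s" "\<forall>\<^sub>F m in sequentially. s m \<in> V"
        using y by (rule extension_ringE)
      have "specialises (1 - of_nat p * (0 - y)) (\<lambda>m. 1 - of_nat p * (0 - s m))"
        by (intro specialises_mult specialises_diff specialises_const s(1)) simp_all
      then have "specialises (1 + of_nat p * y) (\<lambda>m. 1 + of_nat p * s m)" by simp
      from specialises_inverse[OF this] show ?thesis
        by (rule extension_ringI) (use s(2) in eventually_elim, rule one_plus_p_unit)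
    qed
    show "\<exists>T. finite T \<and> Y \<subseteq> T \<and> closed_mod (of_nat p) extension_ring T"
      if "finite Y" "Y \<subseteq> extension_ring" for Y using that by (rule residues_extension_ring)
  qed
qed

end

text \<open>
  The approximations of t start at an integer a where the denominators of the given elements do not
  vanish, and the ring V is chosen to contain the inverses of the values of the denominators at a. All
  approximations are congruent to a modulo p, so the denominators take unit values along them.
\<close>

lemma has_padic_rings_transcendental:
  assumes K: "has_padic_rings K" and t: "\<And>f. f \<in> polys_over K \<Longrightarrow> poly f t = 0 \<Longrightarrow> f = 0"
  shows "has_padic_rings (adjoin_fractions K t)"
proof -
  interpret K: subring_set K using K by (simp add: has_padic_rings_def)
  interpret transcendental_extension K t by unfold_locales (rule t)
  have K_countable: "countable K" using K by (simp add: has_padic_rings_def)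
  have inv: "\<And>c. c \<in> K \<Longrightarrow> inverse c \<in> K" using K by (simp add: has_padic_rings_def)
  show ?thesis unfolding has_padic_rings_def
  proof (intro conjI allI impI ballI)
    have "adjoin_fractions K t \<subseteq> (\<lambda>(f, g). poly f t / poly g t) ` (polys_over K \<times> polys_over K)"
      by (auto simp: adjoin_fractions_def)
    then show "countable (adjoin_fractions K t)"
      by (rule countable_subset) (intro countable_image countable_SIGMA countable_polys_over K_countable)
    show "subring_set (adjoin_fractions K t)" by (rule subring_adjoin_fractions)
    show "inverse y \<in> adjoin_fractions K t" if "y \<in> adjoin_fractions K t" for y
      using that by (rule inverse_adjoin_fractions)
    fix B assume B: "finite B \<and> B \<subseteq> adjoin_fractions K t"
    have "\<forall>y\<in>B. \<exists>f g. f \<in> polys_over K \<and> g \<in> polys_over K \<and> g \<noteq> 0 \<and> y = poly f t / poly g t"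
      using B unfolding adjoin_fractions_def by blast
    then obtain F G where FG: "\<And>y. y \<in> B \<Longrightarrow> F y \<in> polys_over K" "\<And>y. y \<in> B \<Longrightarrow> G y \<in> polys_over K"
      "\<And>y. y \<in> B \<Longrightarrow> G y \<noteq> 0" "\<And>y. y \<in> B \<Longrightarrow> y = poly (F y) t / poly (G y) t"
      by metis
    have "(\<Prod>y\<in>B. G y) \<noteq> 0" using B FG(3) by simp
    from ex_int_nonroot[OF this, of 1 0] obtain a where a: "poly (\<Prod>y\<in>B. G y) (of_int a) \<noteq> 0" by auto
    have Ga: "poly (G y) (of_int a) \<noteq> 0" if y: "y \<in> B" for y
      using a y B by (auto simp: poly_prod)
    define B0 where "B0 = (\<Union>y\<in>B. range (coeff (F y)) \<union> range (coeff (G y)) \<union> {inverse (poly (G y) (of_int a))})"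
    have "finite B0" using B finite_coeffs by (auto simp: B0_def)
    moreover have "B0 \<subseteq> K"
    proof
      fix c assume "c \<in> B0"
      then obtain y where y: "y \<in> B" "c \<in> range (coeff (F y)) \<union> range (coeff (G y)) \<union> {inverse (poly (G y) (of_int a))}"
        unfolding B0_def by blast
      have "poly (G y) (of_int a) \<in> K" using FG(2)[OF y(1)] by simp
      then show "c \<in> K" using y(2) FG(1,2)[OF y(1)] inv by (auto simp: polys_over_def)
    qed
    ultimately obtain p V where V: "padic_ring p K V" "B0 \<subseteq> V"
      using K unfolding has_padic_rings_def by blast
    interpret V: padic_ring p K V by (rule V(1))
    obtain \<tau> :: "nat \<Rightarrow> int" where \<tau>: "\<And>m. int p dvd \<tau> m - a"
      "\<And>e. \<exists>N. \<forall>m\<ge>N. \<forall>n\<ge>N. int p ^ e dvd \<tau> m - \<tau> n"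
      "\<And>f. f \<in> polys_over K \<Longrightarrow> f \<noteq> 0 \<Longrightarrow> \<exists>N s. \<forall>m\<ge>N. poly f (of_int (\<tau> m)) \<noteq> 0 \<and>
        of_nat p ^ s * inverse (poly f (of_int (\<tau> m))) \<in> V"
      using V.ex_generic_integer_sequence[OF K_countable, of a] by metis
    interpret transcendental_padic_extension p K V t \<tau>
      by unfold_locales (use \<tau> in blast)+
    have "B \<subseteq> extension_ring"
    proof
      fix y assume y: "y \<in> B"
      have sub: "range (coeff (F y)) \<subseteq> V" "range (coeff (G y)) \<subseteq> V" "inverse (poly (G y) (of_int a)) \<in> V"
        using V(2) y unfolding B0_def by blast+
      then have VFG: "F y \<in> polys_over V" "G y \<in> polys_over V" by (auto simp: polys_over_def)
      have "poly (F y) (of_int (\<tau> m)) / poly (G y) (of_int (\<tau> m)) \<in> V" for m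
      proof -
        obtain j where j: "\<tau> m - a = int p * j" using \<tau>(1)[of m] by (rule dvdE)
        obtain w where w: "w \<in> V" "poly (G y) (of_int (\<tau> m)) - poly (G y) (of_int a) = (of_int (\<tau> m) - of_int a) * w"
          using V.poly_diff_factor[OF VFG(2), of "of_int (\<tau> m)" "of_int a"] by auto
        define c where "c = poly (G y) (of_int a)"
        define z where "z = of_int j * w * inverse c"
        have c: "c \<noteq> 0" "inverse c \<in> V" "c \<in> K" unfolding c_def using Ga[OF y] sub(3) FG(2)[OF y] by simp_all
        have z: "z \<in> V" unfolding z_def using w(1) c(2) by simp
        have "(of_int (\<tau> m) - of_int a :: 'a) = of_int (int p * j)" unfolding j[symmetric] by simp
        then have "poly (G y) (of_int (\<tau> m)) - c = of_nat p * of_int j * w" using w(2) unfolding c_def by simp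
        also have "\<dots> = c * (of_nat p * z)" using c(1) by (simp add: z_def mult_ac)
        finally have "poly (G y) (of_int (\<tau> m)) = c * (1 + of_nat p * z)" by (simp add: algebra_simps)
        then have "inverse (poly (G y) (of_int (\<tau> m))) \<in> V"
          using V.one_plus_p_multiple_unit(2)[OF c(3,1) _ z, of 0] c(2) by simp
        moreover have "poly (F y) (of_int (\<tau> m)) \<in> V" using VFG(1) by simp
        ultimately show ?thesis unfolding divide_inverse by (intro V.mult_in)
      qed
      then have mem: "\<forall>\<^sub>F m in sequentially. poly (F y) (of_int (\<tau> m)) / poly (G y) (of_int (\<tau> m)) \<in> V"
        by simp
      have "specialises y (\<lambda>m. poly (F y) (of_int (\<tau> m)) / poly (G y) (of_int (\<tau> m)))"
        using FG[OF y] by (rule specialisesI) simp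
      then show "y \<in> extension_ring" using mem by (rule extension_ringI)
    qed
    then show "\<exists>p V. padic_ring p (adjoin_fractions K t) V \<and> B \<subseteq> V" using padic_ring_extension by blast
  qed
qed

text \<open>
  A finite set of numbers is contained in a field obtained from the rationals by finitely many
  extensions, each either algebraic or purely transcendental of degree one.
\<close>

theorem ex_has_padic_rings:
  assumes "finite S"
  shows "\<exists>K. has_padic_rings K \<and> S \<subseteq> K"
  using assms
proof (induction S rule: finite_induct)
  case empty
  then show ?case using has_padic_rings_Rats by blast
next
  case (insert x S)
  then obtain K where K: "has_padic_rings K" "S \<subseteq> K" by blast
  interpret K: subring_set K using K(1) by (simp add: has_padic_rings_def)
  show ?case
  proof (cases "\<exists>g\<in>polys_over K. g \<noteq> 0 \<and> poly g x = 0")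
    case True
    then have "has_padic_rings (adjoin K x)" using has_padic_rings_algebraic[OF K(1)] by blast
    moreover have "insert x S \<subseteq> adjoin K x" using K.insert_subset_adjoin[of x] K(2) by blast
    ultimately show ?thesis by blast
  next
    case False
    then have "has_padic_rings (adjoin_fractions K x)"
      using has_padic_rings_transcendental[OF K(1)] by blast
    moreover have "insert x S \<subseteq> adjoin_fractions K x"
      using K.insert_subset_adjoin[of x] K.adjoin_subset_fractions[of x] K(2) by blast
    ultimately show ?thesis by blast
  qed
qed

section \<open>The Skolem-Mahler-Lech theorem\<close>

text \<open>
  These are the sums of polynomials times powers. The polynomials are expanded in binomial
  coefficients because the difference operator maps n choose (i + 1) to n choose i, which makes linear
  recurrences solvable term by term.
\<close>

inductive exp_poly :: "(nat \<Rightarrow> 'a::field_char_0) \<Rightarrow> bool" where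
  exp_poly_0: "exp_poly (\<lambda>n. 0)"
| exp_poly_term: "exp_poly u \<Longrightarrow> l \<noteq> 0 \<Longrightarrow> exp_poly (\<lambda>n. c * of_nat (n choose i) * l ^ n + u n)"

context padic_ring
begin

lemma analytic_pow: "analytic u \<Longrightarrow> analytic (\<lambda>m. u m ^ k)"
  by (induction k) (simp_all add: analytic_const analytic_mult)

lemma analytic_prod:
  "(\<And>i. i \<in> I \<Longrightarrow> analytic (u i)) \<Longrightarrow> analytic (\<lambda>m. \<Prod>i\<in>I. u i m)"
  by (induction I rule: infinite_finite_induct) (auto intro: analytic_mult analytic_const)

lemma analytic_linear: "a \<in> V \<Longrightarrow> b \<in> V \<Longrightarrow> analytic (\<lambda>m. a * of_nat m + b)"
  using analytic_poly[of "[:b, a:]"] by (simp add: mult.commute add.commute)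

lemma analytic_choose:
  assumes "inverse (fact i) \<in> V"
  shows "analytic (\<lambda>m. of_nat ((M * m + r) choose i))"
proof -
  have "analytic (\<lambda>m. inverse (fact i) * (\<Prod>j = 0..<i. of_nat M * of_nat m + (of_nat r - of_nat j)))"
    by (intro analytic_mult analytic_const analytic_prod analytic_linear assms) simp_all
  moreover have "inverse (fact i) * (\<Prod>j = 0..<i. of_nat M * of_nat m + (of_nat r - of_nat j)) =
      (of_nat ((M * m + r) choose i) :: 'a)" for m
    by (simp add: binomial_gbinomial gbinomial_prod_rev divide_inverse mult.commute add_diff_eq)
  ultimately show ?thesis by simp
qed

end

text \<open>
  The factor k leaves room to pass to a common multiple of the differences when sequences are added.
\<close>

definition (in padic_ring) analytic_on_progressions :: "(nat \<Rightarrow> 'a) \<Rightarrow> bool" where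
  "analytic_on_progressions u \<longleftrightarrow> (\<exists>N\<ge>1. \<forall>k r. analytic (\<lambda>m. u (N * k * m + r)))"

context padic_ring
begin

lemma analytic_on_progressions_add:
  assumes "analytic_on_progressions u" "analytic_on_progressions w"
  shows "analytic_on_progressions (\<lambda>n. u n + w n)"
proof -
  obtain N1 where N1: "N1 \<ge> 1" "\<And>k r. analytic (\<lambda>m. u (N1 * k * m + r))"
    using assms(1) unfolding analytic_on_progressions_def by blast
  obtain N2 where N2: "N2 \<ge> 1" "\<And>k r. analytic (\<lambda>m. w (N2 * k * m + r))"
    using assms(2) unfolding analytic_on_progressions_def by blast
  have "analytic (\<lambda>m. u (N1 * N2 * k * m + r) + w (N1 * N2 * k * m + r))" for k r
  proof (rule analytic_add)
    show "analytic (\<lambda>m. u (N1 * N2 * k * m + r))" using N1(2)[of "N2 * k" r] by (simp add: mult.assoc)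
    show "analytic (\<lambda>m. w (N1 * N2 * k * m + r))" using N2(2)[of "N1 * k" r] by (simp add: mult_ac)
  qed
  moreover have "N1 * N2 \<ge> 1" using N1(1) N2(1) by (simp add: Suc_le_eq)
  ultimately show ?thesis unfolding analytic_on_progressions_def by blast
qed

lemma analytic_on_progressions_term:
  assumes "c \<in> V" "l \<in> V" "inverse l \<in> V" "l \<noteq> 0" "inverse (fact i) \<in> V"
  shows "analytic_on_progressions (\<lambda>n. c * of_nat (n choose i) * l ^ n)"
proof -
  obtain N v where N: "N \<ge> 1" "v \<in> V" "l ^ N = 1 + of_nat p ^ 2 * v"
    using unit_power_cong_one[OF assms(2-4)] by blast
  have "analytic (\<lambda>m. c * of_nat ((N * k * m + r) choose i) * l ^ (N * k * m + r))" for k r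
  proof (intro analytic_mult)
    show "analytic (\<lambda>m. c)" using assms(1) by (rule analytic_const)
    show "analytic (\<lambda>m. of_nat ((N * k * m + r) choose i))" using assms(5) by (rule analytic_choose)
    have "analytic (\<lambda>m. ((1 + of_nat p ^ 2 * v) ^ m) ^ k * l ^ r)"
      using N(2) assms(2) by (intro analytic_mult analytic_pow analytic_power analytic_const) simp_all
    moreover have "((1 + of_nat p ^ 2 * v) ^ m) ^ k * l ^ r = l ^ (N * k * m + r)" for m
      unfolding N(3)[symmetric] by (simp add: power_add mult_ac flip: power_mult)
    ultimately show "analytic (\<lambda>m. l ^ (N * k * m + r))" by simp
  qed
  then show ?thesis using N(1) unfolding analytic_on_progressions_def by blast
qed

text \<open>
  One of the N residue classes contains infinitely many zeros, and analyticity spreads them over the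
  class.
\<close>

lemma analytic_on_progressions_zero:
  assumes "analytic_on_progressions u" "infinite {n. u n = 0}"
  shows "\<exists>N\<ge>1. \<exists>r. \<forall>m. u (N * m + r) = 0"
proof -
  obtain N where N: "N \<ge> 1" "\<And>k r. analytic (\<lambda>m. u (N * k * m + r))"
    using assms(1) unfolding analytic_on_progressions_def by blast
  have "\<exists>r. infinite {n. u n = 0 \<and> n mod N = r}"
  proof (rule ccontr)
    assume "\<nexists>r. infinite {n. u n = 0 \<and> n mod N = r}"
    then have "finite (\<Union>r<N. {n. u n = 0 \<and> n mod N = r})" by blast
    moreover have "{n. u n = 0} = (\<Union>r<N. {n. u n = 0 \<and> n mod N = r})" using N(1) by auto
    ultimately show False using assms(2) by simp
  qed
  then obtain r where r: "infinite {n. u n = 0 \<and> n mod N = r}" by blast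
  have "{n. u n = 0 \<and> n mod N = r} \<subseteq> (\<lambda>m. N * m + r) ` {m. u (N * m + r) = 0}"
  proof
    fix n assume n: "n \<in> {n. u n = 0 \<and> n mod N = r}"
    then have "n = N * (n div N) + r" using mult_div_mod_eq[of N n] by simp
    then show "n \<in> (\<lambda>m. N * m + r) ` {m. u (N * m + r) = 0}"
      using n by (intro image_eqI[of _ _ "n div N"]) simp_all
  qed
  then have "infinite {m. u (N * m + r) = 0}" using r finite_subset by blast
  moreover have "analytic (\<lambda>m. u (N * m + r))" using N(2)[of 1 r] by simp
  ultimately have "u (N * m + r) = 0" for m using analytic_zero by blast
  then show ?thesis using N(1) by blast
qed

end

text \<open>
  The finite set collects the numbers that have to be in V. Its members l and 1/l make l a unit, and
  the inverse of i! makes n choose i a polynomial in n over V.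
\<close>

lemma exp_poly_analytic_on_progressions:
  assumes "exp_poly u"
  shows "\<exists>S. finite S \<and> (\<forall>p K V. padic_ring p K V \<longrightarrow> S \<subseteq> V \<longrightarrow> padic_ring.analytic_on_progressions p V u)"
  using assms
proof induction
  case exp_poly_0
  have "padic_ring.analytic_on_progressions p V (\<lambda>m. 0)" if "padic_ring p K V" for p K and V :: "'a set"
  proof -
    interpret padic_ring p K V by (rule that)
    show ?thesis using analytic_on_progressions_term[of 0 1 0] by simp
  qed
  then show ?case by (intro exI[of _ "{}"]) auto
next
  case (exp_poly_term u l c i)
  obtain S where S: "finite S"
    "\<forall>p K V. padic_ring p K V \<longrightarrow> S \<subseteq> V \<longrightarrow> padic_ring.analytic_on_progressions p V u"
    using exp_poly_term.IH by (elim exE conjE) (rule that)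
  have "padic_ring.analytic_on_progressions p V (\<lambda>n. c * of_nat (n choose i) * l ^ n + u n)"
    if V: "padic_ring p K V" "S \<union> {c, l, inverse l, inverse (fact i)} \<subseteq> V" for p K V
  proof -
    interpret padic_ring p K V by (rule V(1))
    have cl: "c \<in> V" "l \<in> V" "inverse l \<in> V" "inverse (fact i) \<in> V" "S \<subseteq> V" using V(2) by auto
    have "analytic_on_progressions u" using S(2) V(1) cl(5) by blast
    then show ?thesis
      using analytic_on_progressions_term[OF cl(1-3) exp_poly_term.hyps(2) cl(4)]
      by (intro analytic_on_progressions_add)
  qed
  then show ?case using S(1) by (intro exI[of _ "S \<union> {c, l, inverse l, inverse (fact i)}"]) auto
qed

text \<open>
  A single ring V serves for the whole sequence, because u depends on finitely many numbers only.
\<close>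

theorem skolem_mahler_lech:
  assumes "exp_poly u" "infinite {n. u n = 0}"
  shows "\<exists>N\<ge>1. \<exists>r. \<forall>m. u (N * m + r) = 0"
proof -
  obtain S where S: "finite S"
    "\<forall>p K V. padic_ring p K V \<longrightarrow> S \<subseteq> V \<longrightarrow> padic_ring.analytic_on_progressions p V u"
    using exp_poly_analytic_on_progressions[OF assms(1)] by (elim exE conjE) (rule that)
  obtain K where K: "has_padic_rings K" "S \<subseteq> K" using ex_has_padic_rings[OF S(1)] by blast
  obtain p V where V: "padic_ring p K V" "S \<subseteq> V"
    using K S(1) unfolding has_padic_rings_def by blast
  interpret padic_ring p K V by (rule V(1))
  have "analytic_on_progressions u" using S(2) V by blast
  then show ?thesis using assms(2) by (rule analytic_on_progressions_zero)
qed

lemma exp_poly_add: "exp_poly u \<Longrightarrow> exp_poly w \<Longrightarrow> exp_poly (\<lambda>n. u n + w n)"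
proof (induction rule: exp_poly.induct)
  case (exp_poly_term u l c i)
  then show ?case using exp_poly.exp_poly_term[of "\<lambda>n. u n + w n" l c i] by (simp add: add.assoc)
qed simp

lemma exp_poly_single: "l \<noteq> 0 \<Longrightarrow> exp_poly (\<lambda>n. c * of_nat (n choose i) * l ^ n)"
  using exp_poly_term[OF exp_poly_0, of l c i] by simp

lemma exp_poly_shift: "exp_poly u \<Longrightarrow> exp_poly (\<lambda>n. u (Suc n))"
proof (induction rule: exp_poly.induct)
  case (exp_poly_term u l c i)
  have "exp_poly (\<lambda>n. c * of_nat (Suc n choose i) * l ^ Suc n)"
  proof (cases i)
    case 0
    then show ?thesis using exp_poly_single[OF exp_poly_term.hyps(2), of "c * l" 0] by (simp add: mult_ac)
  next
    case (Suc j)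
    have "c * of_nat (Suc n choose i) * l ^ Suc n =
        (c * l) * of_nat (n choose i) * l ^ n + (c * l) * of_nat (n choose j) * l ^ n" for n
      by (simp add: Suc algebra_simps)
    then show ?thesis using exp_poly_term.hyps(2) by (simp only:) (intro exp_poly_add exp_poly_single)
  qed
  then show ?case using exp_poly_add exp_poly_term.IH by blast
qed (rule exp_poly_0)

text \<open>
  In the resonant case g = l the degree goes up by one, as for ordinary differential equations.
  Otherwise the operator acts on the leading term as multiplication by g - l, and the lower term is
  removed by induction.
\<close>

lemma exp_poly_particular_solution_single:
  assumes "l \<noteq> 0" "g \<noteq> 0"
  shows "\<exists>s. exp_poly s \<and> (\<forall>n. s (Suc n) - l * s n = c * of_nat (n choose i) * g ^ n)"
proof (cases "g = l")
  case True
  have "(c / l) * of_nat (Suc n choose Suc i) * l ^ Suc n - l * ((c / l) * of_nat (n choose Suc i) * l ^ n) =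
      c * of_nat (n choose i) * g ^ n" for n
    using assms True by (simp add: field_simps)
  then show ?thesis using exp_poly_single[OF assms(1), of "c / l" "Suc i"] by blast
next
  case False
  then have gl: "g - l \<noteq> 0" by simp
  show ?thesis
  proof (induction i arbitrary: c)
    case 0
    define d where "d = c / (g - l)"
    have d: "d * (g - l) = c" using gl by (simp add: d_def)
    have "d * of_nat (Suc n choose 0) * g ^ Suc n - l * (d * of_nat (n choose 0) * g ^ n) =
        c * of_nat (n choose 0) * g ^ n" for n
      unfolding d[symmetric] by (simp add: algebra_simps)
    then show ?case using exp_poly_single[OF assms(2), of d 0] by blast
  next
    case (Suc i)
    obtain s where s: "exp_poly s"
      "\<And>n. s (Suc n) - l * s n = - (c / (g - l) * g) * of_nat (n choose i) * g ^ n"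
      using Suc.IH by blast
    define d where "d = c / (g - l)"
    have d: "d * (g - l) = c" using gl by (simp add: d_def)
    have "(d * of_nat (Suc n choose Suc i) * g ^ Suc n + s (Suc n)) - l * (d * of_nat (n choose Suc i) * g ^ n + s n) =
        d * (g - l) * of_nat (n choose Suc i) * g ^ n + d * g * of_nat (n choose i) * g ^ n + (s (Suc n) - l * s n)" for n
      by (simp add: algebra_simps)
    then have "(d * of_nat (Suc n choose Suc i) * g ^ Suc n + s (Suc n)) - l * (d * of_nat (n choose Suc i) * g ^ n + s n) =
        c * of_nat (n choose Suc i) * g ^ n" for n
      unfolding s(2) d by (simp add: d_def)
    then show ?case
      using exp_poly_term[OF s(1) assms(2), of d "Suc i"]
      by (intro exI[of _ "\<lambda>n. d * of_nat (n choose Suc i) * g ^ n + s n"]) simp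
  qed
qed

lemma exp_poly_particular_solution:
  assumes "exp_poly w" "l \<noteq> 0"
  shows "\<exists>s. exp_poly s \<and> (\<forall>n. s (Suc n) - l * s n = w n)"
  using assms(1)
proof induction
  case exp_poly_0
  show ?case by (intro exI[of _ "\<lambda>n. 0"]) (simp add: exp_poly.exp_poly_0)
next
  case (exp_poly_term u g c i)
  obtain s where s: "exp_poly s" "\<And>n. s (Suc n) - l * s n = u n" using exp_poly_term.IH by blast
  obtain r where r: "exp_poly r" "\<And>n. r (Suc n) - l * r n = c * of_nat (n choose i) * g ^ n"
    using exp_poly_particular_solution_single[OF assms(2) exp_poly_term.hyps(2)] by blast
  have "(r (Suc n) + s (Suc n)) - l * (r n + s n) = c * of_nat (n choose i) * g ^ n + u n" for n
    unfolding r(2)[symmetric] s(2)[symmetric] by (simp add: algebra_simps)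
  then show ?case using exp_poly_add[OF r(1) s(1)] by blast
qed

lemma exp_poly_recurrence:
  assumes "exp_poly w" "l \<noteq> 0" "\<And>n. n \<ge> n0 \<Longrightarrow> a (Suc n) - l * a n = w n"
  shows "\<exists>u. exp_poly u \<and> (\<forall>n\<ge>n0. a n = u n)"
proof -
  obtain s where s: "exp_poly s" "\<And>n. s (Suc n) - l * s n = w n"
    using exp_poly_particular_solution[OF assms(1,2)] by blast
  define c where "c = (a n0 - s n0) / l ^ n0"
  have "a n - s n = c * l ^ n" if "n \<ge> n0" for n
    using that
  proof (induction n rule: dec_induct)
    case base
    then show ?case using assms(2) by (simp add: c_def)
  next
    case (step n)
    have "a (Suc n) - s (Suc n) = l * (a n - s n)"
      using assms(3)[OF step.hyps(1)] s(2)[of n] by (simp add: algebra_simps)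
    then show ?case using step.IH by simp
  qed
  then have "a n = c * of_nat (n choose 0) * l ^ n + s n" if "n \<ge> n0" for n
    using that by (simp add: algebra_simps)
  then show ?thesis using exp_poly_term[OF s(1) assms(2), of c 0] by blast
qed

text \<open>
  Each root 1/l of the denominator splits off a factor 1 - l X, which turns the coefficients into the
  solution of a first-order recurrence with right-hand side of the same type. This yields the closed
  form without partial fractions.
\<close>

lemma rational_fps_coeffs_exp_poly:
  fixes g :: "complex poly"
  assumes "poly g 0 \<noteq> 0" "fps_of_poly g * A = fps_of_poly f"
  shows "\<exists>u n0. exp_poly u \<and> (\<forall>n\<ge>n0. fps_nth A n = u n)"
  using assms
proof (induction "degree g" arbitrary: g A)
  case 0
  then obtain c where c: "g = [:c:]" by (auto elim: degree_eq_zeroE)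
  then have "c \<noteq> 0" using 0 by simp
  have "fps_nth A n = 0" if "n \<ge> Suc (degree f)" for n
  proof -
    have "c * fps_nth A n = coeff f n"
      using 0(3) c by (metis fps_of_poly_const fps_mult_left_const_nth fps_of_poly_nth)
    then show ?thesis using that \<open>c \<noteq> 0\<close> by (simp add: coeff_eq_0)
  qed
  then show ?case using exp_poly_0 by blast
next
  case (Suc d)
  have "\<not> constant (poly g)" using Suc.hyps(2) by (simp add: constant_degree)
  then obtain z where z: "poly g z = 0" using fundamental_theorem_of_algebra by blast
  then have z0: "z \<noteq> 0" using Suc.prems(1) by auto
  obtain q where q: "g = [:- z, 1:] * q" using z by (auto simp: poly_eq_0_iff_dvd elim: dvdE)
  define l where "l = 1 / z"
  define g' where "g' = smult (- z) q"
  have l: "l \<noteq> 0" using z0 by (simp add: l_def)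
  have g: "g = g' * [:1, - l:]" unfolding q g'_def l_def using z0 by simp
  have "q \<noteq> 0" using Suc.prems(1) q by auto
  then have "degree g = Suc (degree q)" unfolding q by (simp add: degree_mult_eq del: mult_pCons_left)
  then have deg: "degree g' = d" using Suc.hyps(2) z0 by (simp add: g'_def)
  define A' where "A' = fps_of_poly [:1, - l:] * A"
  have "poly g' 0 \<noteq> 0" using Suc.prems(1) unfolding g by simp
  moreover have "fps_of_poly g' * A' = fps_of_poly f"
    using Suc.prems(2) unfolding g A'_def fps_of_poly_mult by (simp add: mult.assoc)
  ultimately obtain w n0 where w: "exp_poly w" "\<And>n. n \<ge> n0 \<Longrightarrow> fps_nth A' n = w n"
    using Suc.hyps(1)[of g' A'] deg by blast
  have "fps_nth A (Suc n) - l * fps_nth A n = w (Suc n)" if "n \<ge> n0" for n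
  proof -
    have "A' = A - fps_const l * (fps_X * A)"
      by (simp add: A'_def fps_of_poly_pCons algebra_simps flip: fps_const_neg)
    then have "fps_nth A' (Suc n) = fps_nth A (Suc n) - l * fps_nth A n" by simp
    then show ?thesis using w(2)[of "Suc n"] that by simp
  qed
  from exp_poly_recurrence[OF exp_poly_shift[OF w(1)] l this] show ?case by blast
qed

section \<open>Poles of rational functions\<close>

lemma has_fps_expansion_poly: "poly f has_fps_expansion fps_of_poly (f :: complex poly)"
  by (simp add: has_fps_expansion_def)

lemma coprime_no_common_root:
  fixes f g :: "complex poly"
  assumes "coprime f g" "poly g z = 0"
  shows "poly f z \<noteq> 0"
proof
  assume "poly f z = 0"
  then have "[:- z, 1:] dvd f" "[:- z, 1:] dvd g" using assms(2) by (simp_all add: poly_eq_0_iff_dvd)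
  then have "is_unit [:- z, 1:]" using assms(1) by (meson coprime_common_divisor)
  then show False by (simp add: is_unit_pCons_iff)
qed

lemma rat_fun_coprime:
  obtains f g where "rat_fun F = (\<lambda>z. poly f z / poly g z)" "g \<noteq> 0" "\<And>z. poly g z = 0 \<Longrightarrow> poly f z \<noteq> 0"
proof
  show "rat_fun F = (\<lambda>z. poly (fst (quot_of_fract F)) z / poly (snd (quot_of_fract F)) z)"
    by (simp add: rat_fun_def fun_eq_iff)
qed (use coprime_no_common_root[OF coprime_quot_of_fract] in auto)

lemma is_pole_quotient_iff:
  fixes f g :: "complex poly"
  assumes "g \<noteq> 0" and coprime: "\<And>z. poly g z = 0 \<Longrightarrow> poly f z \<noteq> 0"
  shows "is_pole (\<lambda>z. poly f z / poly g z) z \<longleftrightarrow> poly g z = 0"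
proof
  assume pole: "is_pole (\<lambda>z. poly f z / poly g z) z"
  show "poly g z = 0"
  proof (rule ccontr)
    assume "poly g z \<noteq> 0"
    then have "((\<lambda>z. poly f z / poly g z) \<longlongrightarrow> poly f z / poly g z) (at z)"
      by (intro tendsto_intros) auto
    then show False using pole unfolding is_pole_def
      by (meson at_neq_bot not_tendsto_and_filterlim_at_infinity)
  qed
next
  assume z: "poly g z = 0"
  have "finite {w. poly g w = 0}" using assms(1) by (rule poly_roots_finite)
  then have "open (- ({w. poly g w = 0} - {z}))" by (intro open_Compl finite_imp_closed) simp
  then have "\<forall>\<^sub>F w in at z. w \<in> - ({w. poly g w = 0} - {z})" by (rule eventually_at_in_open') simp
  then have "\<forall>\<^sub>F w in at z. poly g w \<noteq> 0"
    using eventually_neq_at_within[of z z UNIV] by eventually_elim auto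
  moreover have "(poly g \<longlongrightarrow> 0) (at z)" using z by (metis isCont_def poly_isCont)
  ultimately have "filterlim (poly g) (at 0) (at z)" by (simp add: filterlim_at)
  moreover have "(poly f \<longlongrightarrow> poly f z) (at z)" by (metis isCont_def poly_isCont)
  ultimately show "is_pole (\<lambda>z. poly f z / poly g z) z"
    unfolding is_pole_def using coprime[OF z] by (intro filterlim_divide_at_infinity)
qed

text \<open>
  A function with a power series expansion at 0 is continuous there, so the denominator cannot vanish
  at 0.
\<close>

lemma quotient_fps_expansion:
  fixes f g :: "complex poly"
  assumes "g \<noteq> 0" and coprime: "\<And>z. poly g z = 0 \<Longrightarrow> poly f z \<noteq> 0"
    and A: "(\<lambda>z. poly f z / poly g z) has_fps_expansion A"
  shows "poly g 0 \<noteq> 0" "fps_of_poly g * A = fps_of_poly f"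
proof -
  show g0: "poly g 0 \<noteq> 0"
  proof
    assume "poly g 0 = 0"
    then have "is_pole (\<lambda>z. poly f z / poly g z) 0" using is_pole_quotient_iff assms(1,2) by blast
    moreover have "isCont (\<lambda>z. poly f z / poly g z) 0" using A by (rule has_fps_expansion_imp_continuous)
    ultimately show False unfolding is_pole_def isCont_def
      by (meson at_neq_bot not_tendsto_and_filterlim_at_infinity)
  qed
  have "(\<lambda>z. poly g z * (poly f z / poly g z)) has_fps_expansion fps_of_poly g * A"
    by (intro has_fps_expansion_mult has_fps_expansion_poly A)
  moreover have "\<forall>\<^sub>F z in nhds 0. poly g z * (poly f z / poly g z) = poly f z"
  proof -
    have "\<forall>\<^sub>F z in nhds 0. poly g z \<noteq> 0"
      using g0 by (intro tendsto_imp_eventually_ne[where c = "poly g 0"]) (auto intro: tendsto_intros filterlim_ident)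
    then show ?thesis by eventually_elim simp
  qed
  ultimately have "poly f has_fps_expansion fps_of_poly g * A"
    by (subst (asm) has_fps_expansion_cong) auto
  then show "fps_of_poly g * A = fps_of_poly f"
    using has_fps_expansion_poly fps_expansion_unique_complex by blast
qed

definition primitive_root :: "nat \<Rightarrow> complex" where
  "primitive_root N = exp (2 * of_real pi * \<i> / of_nat N)"

lemma primitive_root_power:
  assumes "N \<ge> 1"
  shows "primitive_root N ^ j = 1 \<longleftrightarrow> N dvd j"
proof -
  have "primitive_root N ^ j = exp (2 * of_real pi * \<i> * of_nat j / of_nat N)"
    unfolding primitive_root_def by (simp flip: exp_of_nat_mult add: mult_ac)
  then show ?thesis using complex_root_unity_eq_1[OF assms, of j] by simp
qed

text \<open>
  The coefficient of z^n in the sum is the n-th coefficient of A times the sum of w^(j (n - r)) over j.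
  This sum vanishes unless N divides n - r, and for such n \<ge> r the coefficient of A vanishes. So only
  coefficients of index below r survive.
\<close>

lemma root_of_unity_filter:
  assumes N: "N \<ge> 1" and "\<And>m. fps_nth A (N * m + r) = 0" and A: "F has_fps_expansion A"
  defines "w \<equiv> primitive_root N"
  shows "\<exists>h. \<forall>\<^sub>F z in nhds 0. (\<Sum>j<N. inverse (w ^ r) ^ j * F (w ^ j * z)) = poly h z"
proof -
  have w: "w ^ j = 1 \<longleftrightarrow> N dvd j" for j unfolding w_def by (rule primitive_root_power[OF N])
  have "w ^ N = 1" using w by simp
  then have w0: "w \<noteq> 0" using N by (auto simp: power_0_left)
  define B where "B = (\<Sum>j<N. fps_const (inverse (w ^ r) ^ j) * fps_compose A (fps_const (w ^ j) * fps_X))"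
  have B: "(\<lambda>z. \<Sum>j<N. inverse (w ^ r) ^ j * F (w ^ j * z)) has_fps_expansion B"
  proof -
    have "(F \<circ> (\<lambda>z. w ^ j * z)) has_fps_expansion fps_compose A (fps_const (w ^ j) * fps_X)" for j
      by (intro has_fps_expansion_compose A has_fps_expansion_cmult_left has_fps_expansion_fps_X) simp
    then show ?thesis unfolding B_def o_def
      by (intro has_fps_expansion_sum has_fps_expansion_cmult_left)
  qed
  have "fps_nth B n = 0" if n: "n \<ge> r" for n
  proof (cases "N dvd n - r")
    case True
    then obtain m where "n - r = N * m" by (rule dvdE)
    then have "n = N * m + r" using n by simp
    then show ?thesis using assms(2) by (simp add: B_def fps_sum_nth fps_compose_linear)
  next
    case False
    define q where "q = w ^ (n - r)"
    have q: "q \<noteq> 1" "q ^ N = 1" using False w[of "n - r"] w[of "(n - r) * N"] by (simp_all add: q_def power_mult)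
    have wn: "w ^ n = w ^ r * q" using n by (simp add: q_def flip: power_add)
    have term_eq: "inverse (w ^ r) ^ j * ((w ^ j) ^ n * fps_nth A n) = fps_nth A n * q ^ j" for j
    proof -
      have "(w ^ j) ^ n = (w ^ n) ^ j" by (simp add: mult.commute flip: power_mult)
      also have "\<dots> = (w ^ r) ^ j * q ^ j" unfolding wn by (rule power_mult_distrib)
      finally show ?thesis using w0 by (simp add: power_inverse)
    qed
    have "fps_nth B n = (\<Sum>j<N. inverse (w ^ r) ^ j * ((w ^ j) ^ n * fps_nth A n))"
      by (simp add: B_def fps_sum_nth fps_compose_linear)
    also have "\<dots> = fps_nth A n * (\<Sum>j<N. q ^ j)"
      by (simp only: term_eq sum_distrib_left)
    also have "(\<Sum>j<N. q ^ j) = 0" using q by (simp add: geometric_sum)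
    finally show ?thesis by simp
  qed
  then have "B = fps_of_poly (Poly (map (fps_nth B) [0..<r]))"
    by (auto simp: fps_eq_iff coeff_Poly_eq nth_default_def)
  then have "(\<lambda>z. \<Sum>j<N. inverse (w ^ r) ^ j * F (w ^ j * z)) has_fps_expansion fps_of_poly (Poly (map (fps_nth B) [0..<r]))"
    using B by simp
  then have "\<forall>\<^sub>F z in nhds 0. poly (Poly (map (fps_nth B) [0..<r])) z =
      (\<Sum>j<N. inverse (w ^ r) ^ j * F (w ^ j * z))"
    by (simp add: has_fps_expansion_def)
  then show ?thesis by (intro exI[of _ "Poly (map (fps_nth B) [0..<r])"]) (auto elim: eventually_mono)
qed

text \<open>
  If no w^j \<alpha> with 0 < j < N were a pole, the
  polynomial identity for the rotated functions would express F near \<alpha> by functions continuous at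
  \<alpha>.
\<close>

theorem pole_ratio_root_of_unity:
  fixes f g :: "complex poly" and A :: "complex fps"
  assumes g: "g \<noteq> 0" and coprime: "\<And>z. poly g z = 0 \<Longrightarrow> poly f z \<noteq> 0"
    and A: "(\<lambda>z. poly f z / poly g z) has_fps_expansion A"
    and zeros: "infinite {n. fps_nth A n = 0}" and \<alpha>: "poly g \<alpha> = 0"
  shows "\<exists>w N. N \<ge> 1 \<and> w ^ N = 1 \<and> w \<noteq> 1 \<and> poly g (w * \<alpha>) = 0"
proof -
  note A' = quotient_fps_expansion[OF g coprime A]
  obtain u n0 where u: "exp_poly u" "\<forall>n\<ge>n0. fps_nth A n = u n"
    using rational_fps_coeffs_exp_poly[OF A'] by blast
  have "{n. fps_nth A n = 0} \<subseteq> {..<n0} \<union> {n. u n = 0}"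
  proof
    fix n assume "n \<in> {n. fps_nth A n = 0}"
    then show "n \<in> {..<n0} \<union> {n. u n = 0}" using u(2) by (cases "n < n0") auto
  qed
  then have "infinite {n. u n = 0}" using zeros finite_subset by blast
  from skolem_mahler_lech[OF u(1) this] obtain N r where N: "N \<ge> 1" "\<forall>m. u (N * m + r) = 0" by blast
  \<comment> \<open>the progression is shifted beyond n0, where the coefficients agree with u\<close>
  define r' where "r' = N * n0 + r"
  have A_zero: "fps_nth A (N * m + r') = 0" for m
  proof -
    have "N * m + r' = N * (m + n0) + r" by (simp add: r'_def algebra_simps)
    moreover have "N * (m + n0) \<ge> n0" using N(1) by (metis le_add2 le_trans mult_le_mono1 nat_mult_1)
    ultimately show ?thesis using u(2) N(2) by simp
  qed
  define w where "w = primitive_root N"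
  have w: "w ^ j = 1 \<longleftrightarrow> N dvd j" for j unfolding w_def by (rule primitive_root_power[OF N(1)])
  have "w ^ N = 1" using w by simp
  then have w0: "w \<noteq> 0" using N(1) by (auto simp: power_0_left)
  define F where "F z = poly f z / poly g z" for z
  define c where "c j = inverse (w ^ r') ^ j" for j
  obtain h where h: "\<forall>\<^sub>F z in nhds 0. (\<Sum>j<N. c j * F (w ^ j * z)) = poly h z"
    using root_of_unity_filter[OF N(1) A_zero A] unfolding c_def F_def w_def by blast
  \<comment> \<open>the poles of the rotated functions\<close>
  define T where "T = {z. \<exists>j<N. poly g (w ^ j * z) = 0}"
  have "finite T"
  proof -
    have "T = (\<Union>j<N. (\<lambda>x. x / w ^ j) ` {x. poly g x = 0})"
    proof (intro equalityI subsetI)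
      fix z assume "z \<in> T"
      then obtain j where "j < N" "poly g (w ^ j * z) = 0" by (auto simp: T_def)
      then show "z \<in> (\<Union>j<N. (\<lambda>x. x / w ^ j) ` {x. poly g x = 0})"
        using w0 by (intro UN_I[of j] image_eqI[of _ _ "w ^ j * z"]) auto
    qed (use w0 in \<open>auto simp: T_def\<close>)
    then show ?thesis using poly_roots_finite[OF g] by simp
  qed
  have open_T: "open (UNIV - T)" using \<open>finite T\<close> by (intro open_Diff finite_imp_closed) auto
  have "connected (UNIV - T)" using \<open>finite T\<close> by (intro connected_open_delete_finite) auto
  have g_nz: "poly g (w ^ j * z) \<noteq> 0" if "z \<in> UNIV - T" "j < N" for z j using that by (auto simp: T_def)
  have F_zero: "(\<Sum>j<N. c j * F (w ^ j * z)) - poly h z = 0" if z: "z \<in> UNIV - T" for z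
  proof -
    obtain U where U: "open U" "0 \<in> U" "\<And>z. z \<in> U \<Longrightarrow> (\<Sum>j<N. c j * F (w ^ j * z)) = poly h z"
      using h unfolding eventually_nhds by blast
    have "0 \<in> UNIV - T" using A'(1) by (auto simp: T_def)
    show ?thesis
    proof (rule analytic_continuation_open[of "U \<inter> (UNIV - T)" "UNIV - T"
          "\<lambda>z. (\<Sum>j<N. c j * F (w ^ j * z)) - poly h z" "\<lambda>z. 0"])
      show "(\<lambda>z. (\<Sum>j<N. c j * F (w ^ j * z)) - poly h z) holomorphic_on UNIV - T"
        unfolding F_def using g_nz by (intro holomorphic_intros) auto
    qed (use open_T \<open>connected (UNIV - T)\<close> U \<open>0 \<in> UNIV - T\<close> z in auto)
  qed
  have "\<exists>j. 0 < j \<and> j < N \<and> poly g (w ^ j * \<alpha>) = 0"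
  proof (rule ccontr)
    assume "\<not> ?thesis"
    then have nz: "poly g (w ^ j * \<alpha>) \<noteq> 0" if "j \<in> {1..<N}" for j using that by auto
    have "open (- (T - {\<alpha>}))" using \<open>finite T\<close> by (intro open_Compl finite_imp_closed) simp
    then have "\<forall>\<^sub>F z in at \<alpha>. z \<in> - (T - {\<alpha>})" by (rule eventually_at_in_open') simp
    then have ev: "\<forall>\<^sub>F z in at \<alpha>. poly h z - (\<Sum>j\<in>{1..<N}. c j * F (w ^ j * z)) = F z"
      using eventually_neq_at_within[of \<alpha> \<alpha> UNIV]
    proof eventually_elim
      case (elim z)
      have "{..<N} = insert 0 {1..<N}" using N(1) by auto
      then have "(\<Sum>j<N. c j * F (w ^ j * z)) = F z + (\<Sum>j\<in>{1..<N}. c j * F (w ^ j * z))"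
        by (simp add: c_def)
      moreover have "(\<Sum>j<N. c j * F (w ^ j * z)) = poly h z" using F_zero[of z] elim by simp
      ultimately have "poly h z = F z + (\<Sum>j\<in>{1..<N}. c j * F (w ^ j * z))" by (simp only:)
      then show ?case by (simp only: diff_eq_eq)
    qed
    have "((\<lambda>z. poly h z - (\<Sum>j\<in>{1..<N}. c j * F (w ^ j * z))) \<longlongrightarrow>
        poly h \<alpha> - (\<Sum>j\<in>{1..<N}. c j * F (w ^ j * \<alpha>))) (at \<alpha>)"
      unfolding F_def using nz by (intro tendsto_intros) auto
    then have "(F \<longlongrightarrow> poly h \<alpha> - (\<Sum>j\<in>{1..<N}. c j * F (w ^ j * \<alpha>))) (at \<alpha>)"
      using ev by (rule Lim_transform_eventually)
    moreover have "filterlim F at_infinity (at \<alpha>)"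
      using is_pole_quotient_iff[OF g coprime, of \<alpha>] \<alpha> unfolding is_pole_def F_def by simp
    ultimately show False by (meson at_neq_bot not_tendsto_and_filterlim_at_infinity)
  qed
  then obtain j where j: "0 < j" "j < N" "poly g (w ^ j * \<alpha>) = 0" by blast
  have "w ^ j \<noteq> 1" using j w by (auto dest: dvd_imp_le)
  moreover have "(w ^ j) ^ N = 1" using \<open>w ^ N = 1\<close> by (metis mult.commute power_mult power_one)
  ultimately show ?thesis using N(1) j(3) by blast
qed

theorem proposition3p3:
  fixes F :: "complex poly fract" and a :: "nat \<Rightarrow> complex"
  assumes "rat_fun F has_fps_expansion Abs_fps a"
    and "infinite {n. a n = 0}"
    and "rat_poles F \<noteq> {}"
  shows "\<exists>\<alpha> \<in> min_modulus_poles F. \<exists>\<beta> \<in> min_modulus_poles F.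
           \<alpha> \<noteq> \<beta> \<and> root_of_unity (\<alpha> / \<beta>)"
proof -
  obtain f g where fg: "rat_fun F = (\<lambda>z. poly f z / poly g z)" "g \<noteq> 0"
    "\<And>z. poly g z = 0 \<Longrightarrow> poly f z \<noteq> 0" by (rule rat_fun_coprime[of F]) (rule that)
  have poles: "rat_poles F = {z. poly g z = 0}"
    unfolding rat_poles_def fg(1) using is_pole_quotient_iff[OF fg(2,3)] by auto
  have A: "(\<lambda>z. poly f z / poly g z) has_fps_expansion Abs_fps a" using assms(1) fg(1) by simp
  have g0: "poly g 0 \<noteq> 0" using quotient_fps_expansion(1)[OF fg(2,3) A] .
  have fin: "finite (rat_poles F)" unfolding poles using fg(2) by (rule poly_roots_finite)
  define \<alpha> where "\<alpha> = arg_min_on cmod (rat_poles F)"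
  have \<alpha>: "\<alpha> \<in> rat_poles F" "\<And>z. z \<in> rat_poles F \<Longrightarrow> cmod \<alpha> \<le> cmod z"
    unfolding \<alpha>_def using fin assms(3) by (simp_all add: arg_min_if_finite(1) arg_min_least)
  have "infinite {n. fps_nth (Abs_fps a) n = 0}" using assms(2) by simp
  from pole_ratio_root_of_unity[OF fg(2,3) A this] \<alpha>(1) obtain w N
    where w: "N \<ge> 1" "w ^ N = 1" "w \<noteq> 1" "poly g (w * \<alpha>) = 0"
    unfolding poles by blast
  have "\<alpha> \<noteq> 0" using \<alpha>(1) g0 unfolding poles by auto
  have "cmod w ^ N = 1 ^ N" using w(2) by (simp flip: norm_power)
  then have "cmod w = 1" using w(1) power_eq_imp_eq_base[of "cmod w" N 1] by simp
  then have "cmod (w * \<alpha>) = cmod \<alpha>" by (simp add: norm_mult)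
  then have "w * \<alpha> \<in> min_modulus_poles F" "\<alpha> \<in> min_modulus_poles F"
    using \<alpha> w(4) unfolding min_modulus_poles_def poles by auto
  moreover have "w * \<alpha> \<noteq> \<alpha>" using w(3) \<open>\<alpha> \<noteq> 0\<close> by simp
  moreover have "root_of_unity (w * \<alpha> / \<alpha>)"
    using w(1,2) \<open>\<alpha> \<noteq> 0\<close> unfolding root_of_unity_def by auto
  ultimately show ?thesis by blast
qed

end
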